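(* Let $\Omega\subset\mathbb{C}$ be a domain and let $M$ be a Riemann surface admitting an exhaustion $M=\bigcup_{j=1}^{\infty}M_j$ by open subsets $M_1\subset M_2\subset\cdots$, each $M_j$ biholomorphic to $\Omega$. Assume that $M$ is hyperbolic. \begin{enumerate} \item[(i)] If $\Omega$ is a bounded domain in $\mathbb{C}$ with $C^2$-smooth boundary, then $M$ is biholomorphic either to $\Omega$ or to the unit disc $\Delta=\{z\in\mathbb{C}:|z|<1\}$. \item[(ii)] If $\Omega=D\setminus A$, where $D$ is a bounded domain in $\mathbb{C}$ with $C^2$-smooth boundary and $A\subset D$ is a finite set, then $M$ is biholomorphic either to $\Omega$ or to $\Delta$. \end{enumerate}
   Context: A Riemann surface is a connected one-dimensional complex manifold. A Riemann surface is called hyperbolic if its universal covering surface is the unit disc $\Delta$; for Riemann surfaces this is equivalent to Kobayashi hyperbolicity (the Kobayashi pseudo-distance is a distance). *)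

theory Defs
  imports "HOL-Analysis.Analysis"
begin

definition chart :: "'a topology \<Rightarrow> 'a set \<Rightarrow> ('a \<Rightarrow> complex) \<Rightarrow> bool" where
  "chart X U \<phi> \<longleftrightarrow> openin X U \<and> open (\<phi> ` U) \<and>
     homeomorphic_map (subtopology X U) (top_of_set (\<phi> ` U)) \<phi>"

definition riemann_surface :: "'a topology \<Rightarrow> ('a set \<times> ('a \<Rightarrow> complex)) set \<Rightarrow> bool" where
  "riemann_surface X At \<longleftrightarrow>
     Hausdorff_space X \<and> connected_space X \<and> topspace X \<noteq> {} \<and>
     (\<forall>(U,\<phi>)\<in>At. chart X U \<phi>) \<and>
     topspace X \<subseteq> \<Union>(fst ` At) \<and>
     (\<forall>(U,\<phi>)\<in>At. \<forall>(V,\<psi>)\<in>At. (\<psi> \<circ> inv_into U \<phi>) holomorphic_on (\<phi> ` (U \<inter> V)))"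

definition holo_fun :: "'a topology \<Rightarrow> ('a set \<times> ('a \<Rightarrow> complex)) set \<Rightarrow> 'a set \<Rightarrow> ('a \<Rightarrow> complex) \<Rightarrow> bool" where
  "holo_fun X At W f \<longleftrightarrow> openin X W \<and>
     (\<forall>(U,\<phi>)\<in>At. (f \<circ> inv_into U \<phi>) holomorphic_on (\<phi> ` (U \<inter> W)))"

definition holo_into :: "'a topology \<Rightarrow> ('a set \<times> ('a \<Rightarrow> complex)) set \<Rightarrow> complex set \<Rightarrow> (complex \<Rightarrow> 'a) \<Rightarrow> bool" where
  "holo_into X At S g \<longleftrightarrow> open S \<and> continuous_map (top_of_set S) X g \<and>
     (\<forall>(U,\<phi>)\<in>At. (\<phi> \<circ> g) holomorphic_on (S \<inter> g -` U))"

definition biholo :: "'a topology \<Rightarrow> ('a set \<times> ('a \<Rightarrow> complex)) set \<Rightarrow> 'a set \<Rightarrow> complex set \<Rightarrow> ('a \<Rightarrow> complex) \<Rightarrow> bool" where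
  "biholo X At W S f \<longleftrightarrow> holo_fun X At W f \<and> bij_betw f W S \<and> holo_into X At S (inv_into W f)"

definition covering_map :: "'b topology \<Rightarrow> 'a topology \<Rightarrow> ('b \<Rightarrow> 'a) \<Rightarrow> bool" where
  "covering_map C X p \<longleftrightarrow> continuous_map C X p \<and> p ` topspace C = topspace X \<and>
     (\<forall>x\<in>topspace X. \<exists>U. openin X U \<and> x \<in> U \<and>
        (\<exists>\<V>. \<Union>\<V> = topspace C \<inter> p -` U \<and>
             (\<forall>V\<in>\<V>. openin C V) \<and> pairwise disjnt \<V> \<and>
             (\<forall>V\<in>\<V>. homeomorphic_map (subtopology C V) (subtopology X U) p)))"

text \<open>Hyperbolic: the universal covering is the unit disc, i.e. there is a holomorphic
  covering map from the unit disc (simply connected) onto the surface.\<close>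
definition hyperbolic_rs :: "'a topology \<Rightarrow> ('a set \<times> ('a \<Rightarrow> complex)) set \<Rightarrow> bool" where
  "hyperbolic_rs X At \<longleftrightarrow>
     (\<exists>p. holo_into X At (ball 0 1) p \<and> covering_map (top_of_set (ball 0 1)) X p)"

definition domain :: "complex set \<Rightarrow> bool" where
  "domain S \<longleftrightarrow> open S \<and> connected S \<and> S \<noteq> {}"

definition C1_on :: "'a::real_normed_vector set \<Rightarrow> ('a \<Rightarrow> 'b::real_normed_vector) \<Rightarrow> bool" where
  "C1_on S f \<longleftrightarrow> (\<exists>f'. (\<forall>z\<in>S. (f has_derivative blinfun_apply (f' z)) (at z)) \<and> continuous_on S f')"

definition C2_on :: "'a::real_normed_vector set \<Rightarrow> ('a \<Rightarrow> 'b::real_normed_vector) \<Rightarrow> bool" where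
  "C2_on S f \<longleftrightarrow> (\<exists>f'. (\<forall>z\<in>S. (f has_derivative blinfun_apply (f' z)) (at z)) \<and> C1_on S f')"

text \<open>C^2-smooth boundary via local defining functions with nonvanishing gradient.\<close>
definition C2_boundary :: "complex set \<Rightarrow> bool" where
  "C2_boundary \<Omega> \<longleftrightarrow> (\<forall>p\<in>frontier \<Omega>. \<exists>r>0. \<exists>\<rho>::complex \<Rightarrow> real.
      C2_on (ball p r) \<rho> \<and>
      \<Omega> \<inter> ball p r = {z\<in>ball p r. \<rho> z < 0} \<and>
      (\<forall>z\<in>ball p r. \<rho> z = 0 \<longrightarrow> (\<exists>D. (\<rho> has_derivative D) (at z) \<and> D \<noteq> (\<lambda>_. 0))))"

end

theory Submission
  imports Defs "HOL-Complex_Analysis.Complex_Analysis" "HOL-Library.Diagonal_Subsequence"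
begin

text \<open>
  Let \<open>p\<close> be the universal covering of \<open>M\<close> by the disc and let \<open>S\<^sub>j\<close> be the preimage of \<open>M\<^sub>j\<close>. Composing
  with the biholomorphisms \<open>M\<^sub>j \<rightarrow> \<Omega>\<close> gives holomorphic coverings \<open>F\<^sub>j : S\<^sub>j \<rightarrow> \<Omega>\<close> with the fibres
  of \<open>p\<close>; by Montel we may assume that \<open>F\<^sub>j \<rightarrow> G\<close> locally uniformly on the disc.
  If \<open>G 0 \<in> \<Omega>\<close>, then lifting small balls through \<open>F\<^sub>j\<close> (the lifts take values in the disc, so they are
  uniformly Lipschitz) shows that \<open>G\<close> is nonconstant, has the fibres of \<open>p\<close> and is onto \<open>\<Omega>\<close>; hence
  \<open>M \<cong> \<Omega>\<close>. Otherwise \<open>G\<close> is constant by Hurwitz, so every compact part of the disc is eventually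
  mapped into a small piece of \<open>\<Omega>\<close> near a boundary point or a puncture. Near a boundary point the piece
  is simply connected, and near a puncture its small loop lifts to arbitrarily short arcs; either way \<open>p\<close>
  is injective and \<open>M\<close> is the disc.
\<close>

section \<open>Holomorphic functions, lifts and normal families\<close>

text \<open>Cauchy's inequality on circles of radius \<open>r < R/2\<close> about a point of the
  half ball bounds the derivative by \<open>1/r\<close>; then \<open>r\<close> tends to
  \<open>R/2\<close>, and convexity of the half ball turns the bound into a Lipschitz estimate. The
  constant is the same for all \<open>h\<close>, which makes lifts with values in the disc
  equicontinuous.\<close>

lemma holomorphic_bounded_imp_Lipschitz:
  assumes "h holomorphic_on ball c R" "\<And>z. z \<in> ball c R \<Longrightarrow> norm (h z) \<le> 1"
    and "x \<in> ball c (R/2)" "y \<in> ball c (R/2)"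
  shows "norm (h x - h y) \<le> 2/R * norm (x - y)"
proof -
  have R: "R > 0"
    using assms(3) by (metis ball_eq_empty empty_iff half_gt_zero_iff not_le)
  have der: "norm (deriv h z) \<le> 2/R" if z: "z \<in> ball c (R/2)" for z
  proof -
    have sub: "ball z (R/2) \<subseteq> ball c R"
    proof
      fix w assume "w \<in> ball z (R/2)"
      then have "dist c w < R/2 + R/2"
        using z dist_triangle[of c w z] by (simp add: dist_commute)
      then show "w \<in> ball c R" by simp
    qed
    have bd: "norm (deriv h z) \<le> 1/r" if r: "0 < r" "r < R/2" for r
    proof -
      have s: "cball z r \<subseteq> ball c R"
        using sub r by (auto simp: subset_eq)
      have "norm ((deriv ^^ 1) h z) \<le> fact 1 * 1 / r ^ 1"
        by (rule Cauchy_inequality)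
           (use s r assms(1,2) in \<open>auto intro!: holomorphic_on_subset[OF assms(1)] holomorphic_on_imp_continuous_on
              simp: subset_eq dist_norm norm_minus_commute\<close>)
      then show ?thesis by simp
    qed
    have "((\<lambda>r. 1/r) \<longlongrightarrow> 1/(R/2)) (at_left (R/2))"
      using R by (intro tendsto_intros) auto
    moreover have "\<forall>\<^sub>F r in at_left (R/2). norm (deriv h z) \<le> 1/r"
      unfolding eventually_at_left_field
      using R bd by (intro exI[of _ 0]) auto
    ultimately have "norm (deriv h z) \<le> 1/(R/2)"
      by (rule tendsto_lowerbound) simp
    then show ?thesis by simp
  qed
  have hol: "h holomorphic_on ball c (R/2)"
    using assms(1) R by (auto intro: holomorphic_on_subset)
  show ?thesis
    using field_differentiable_bound[of "ball c (R/2)" h "deriv h" "2/R" x y] der assms(3,4) hol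
    by (meson convex_ball has_field_derivative_at_within holomorphic_derivI open_ball)
qed

lemma holomorphic_local_inverse:
  assumes "h holomorphic_on N" "open N" "inj_on h N" "u \<in> N"
  obtains V k where "open V" "h u \<in> V" "k holomorphic_on V" "k ` V \<subseteq> N" "k (h u) = u"
    "\<And>w. w \<in> V \<Longrightarrow> h (k w) = w"
proof -
  obtain k where "k holomorphic_on (h ` N)" "\<And>z. z \<in> N \<Longrightarrow> k (h z) = z"
    using holomorphic_has_inverse[OF assms(1,2,3)] by metis
  with assms show ?thesis
    by (intro that[of "h ` N" k] open_mapping_thm3) auto
qed

section \<open>Lifting through holomorphic coverings\<close>

lemma covering_space_locally_injective:
  assumes "covering_space C p S" "open C" "u \<in> C"
  obtains N where "open N" "u \<in> N" "N \<subseteq> C" "inj_on p N"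
proof -
  have "p u \<in> S" using assms(1,3) by (auto simp: covering_space_def)
  then obtain T v where T: "p u \<in> T" "\<Union>v = C \<inter> p -` T" "\<And>x. x \<in> v \<Longrightarrow> openin (top_of_set C) x"
     "\<And>x. x \<in> v \<Longrightarrow> \<exists>q. homeomorphism x T p q"
    using assms(1) unfolding covering_space_def by metis
  then obtain x where x: "x \<in> v" "u \<in> x"
    using assms(3) by blast
  then have "open x" "x \<subseteq> C"
    using T(3)[of x] assms(2) openin_open_trans openin_imp_subset by blast+
  moreover have "inj_on p x"
    using T(4)[OF x(1)] by (metis homeomorphism_apply1 inj_on_inverseI)
  ultimately show ?thesis using that x by blast
qed

text \<open>Simple connectedness gives a continuous lift through the prescribed point
  \<open>a\<close>, and a lift through a holomorphic covering is automatically holomorphic. With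
  \<open>f = id\<close> it yields sections over simply connected pieces, with a shifted exponential
  it unrolls a puncture.\<close>

lemma covering_space_holomorphic_lift_at:
  assumes cov: "covering_space C p S" and C: "open C" "p holomorphic_on C" and "a \<in> C" "z \<in> U"
    and U: "simply_connected U" "open U"
    and f: "f holomorphic_on U" "f \<in> U \<rightarrow> S" "f z = p a"
  obtains g where "g holomorphic_on U" "g \<in> U \<rightarrow> C" "g z = a" "\<And>y. y \<in> U \<Longrightarrow> p (g y) = f y"
proof -
  obtain g where g: "continuous_on U g" "g \<in> U \<rightarrow> C" "g z = a" "\<And>y. y \<in> U \<Longrightarrow> p (g y) = f y"
    using covering_space_lift_strong[OF cov \<open>a \<in> C\<close> \<open>z \<in> U\<close> U(1) open_imp_locally_path_connected[OF U(2)]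
      holomorphic_on_imp_continuous_on[OF f(1)] f(2,3)] by blast
  moreover have "g holomorphic_on U"
    using covering_space_lift_is_holomorphic[OF cov C f(1,2) g(2,1) g(4)] .
  ultimately show ?thesis using that by blast
qed

section \<open>Exhaustions of the disc and Montel's theorem\<close>

lemma ball_exhaustion_subset:
  fixes S :: "nat \<Rightarrow> 'b::euclidean_space set"
  assumes "\<And>j. open (S j)" "mono S" "(\<Union>j. S j) = ball 0 1" "compact K" "K \<subseteq> ball 0 1"
  obtains N where "\<And>n. n \<ge> N \<Longrightarrow> K \<subseteq> S n"
proof -
  obtain J where J: "finite J" "K \<subseteq> (\<Union>j\<in>J. S j)"
  proof (rule compactE_image[OF assms(4), of UNIV S])
    show "K \<subseteq> (\<Union>j\<in>UNIV. S j)" using assms(3,5) by simp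
  qed (use assms(1) in auto)
  obtain N where N: "\<And>j. j \<in> J \<Longrightarrow> j \<le> N"
    using J(1) by (meson finite_nat_set_iff_bounded_le)
  have "K \<subseteq> S n" if "n \<ge> N" for n
  proof
    fix x assume "x \<in> K"
    then obtain j where "j \<in> J" "x \<in> S j" using J(2) by blast
    then show "x \<in> S n" using monoD[OF assms(2), of j n] N[of j] that by auto
  qed
  then show ?thesis using that by blast
qed

lemma uniform_limit_shift:
  assumes "uniform_limit K (\<lambda>n. f (n + N)) g sequentially"
  shows "uniform_limit K f g sequentially"
  unfolding uniform_limit_iff
proof (intro allI impI)
  fix e :: real assume "e > 0"
  then have "\<forall>\<^sub>F n in sequentially. \<forall>x\<in>K. dist (f (n + N) x) (g x) < e"
    using assms by (auto simp: uniform_limit_iff)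
  then show "\<forall>\<^sub>F n in sequentially. \<forall>x\<in>K. dist (f n x) (g x) < e"
    by (rule eventually_sequentially_seg[THEN iffD1])
qed

text \<open>Each \<open>F j\<close> is controlled only on \<open>S j\<close>, so Montel's theorem is
  applied on every ball of radius \<open>r n\<close> to a tail of the sequence, and a diagonal
  subsequence serves all radii at once.\<close>

lemma Montel_exhaustion:
  fixes F :: "nat \<Rightarrow> complex \<Rightarrow> complex"
  assumes S: "\<And>j. open (S j)" "mono S" "(\<Union>j. S j) = ball 0 1"
    and F: "\<And>j. F j holomorphic_on S j" and B: "\<And>j z. z \<in> S j \<Longrightarrow> norm (F j z) \<le> B"
  obtains s G where "strict_mono (s :: nat \<Rightarrow> nat)" "G holomorphic_on ball 0 1"
    "\<And>K. \<lbrakk>compact K; K \<subseteq> ball 0 1\<rbrakk> \<Longrightarrow> uniform_limit K (F \<circ> s) G sequentially"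
proof -
  define r where "r n = 1 - 1 / (real n + 2)" for n :: nat
  have r: "0 < r n" "r n < 1" for n by (auto simp: r_def field_simps)
  define P where "P n s \<longleftrightarrow> (\<exists>g. g holomorphic_on ball 0 (r n) \<and>
      (\<forall>K. compact K \<longrightarrow> K \<subseteq> ball 0 (r n) \<longrightarrow> uniform_limit K (F \<circ> s) g sequentially))" for n s
  interpret subseqs P
  proof
    fix n and s :: "nat \<Rightarrow> nat" assume s: "strict_mono s"
    have "cball 0 (r n) \<subseteq> (ball 0 1 :: complex set)" using r(2)[of n] by auto
    then obtain N where N: "\<And>m. m \<ge> N \<Longrightarrow> cball 0 (r n) \<subseteq> S m"
      using ball_exhaustion_subset[OF S compact_cball] by blast
    have sN: "cball 0 (r n) \<subseteq> S (s (k + N))" for k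
      using N[of "s (k+N)"] seq_suble[OF s, of "k+N"] by simp
    obtain g q where g: "g holomorphic_on ball 0 (r n)" "strict_mono q"
      "\<And>K. \<lbrakk>compact K; K \<subseteq> ball 0 (r n)\<rbrakk> \<Longrightarrow> uniform_limit K ((\<lambda>k. F (s (k + N))) \<circ> q) g sequentially"
    proof (rule Montel[of "ball 0 (r n)" "range (\<lambda>k. F (s (k + N)))" "\<lambda>k. F (s (k + N))"])
      show "h holomorphic_on ball 0 (r n)" if "h \<in> range (\<lambda>k. F (s (k + N)))" for h
        using that sN F ball_subset_cball by (metis (no_types, lifting) holomorphic_on_subset imageE)
      show "\<exists>B. \<forall>h\<in>range (\<lambda>k. F (s (k + N))). \<forall>z\<in>K. norm (h z) \<le> B" if "compact K" "K \<subseteq> ball 0 (r n)" for K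
      proof (intro exI[of _ B] ballI)
        fix h z assume "h \<in> range (\<lambda>k. F (s (k + N)))" "z \<in> K"
        then show "norm (h z) \<le> B" using B sN that(2) by (force simp: subset_eq)
      qed
    qed auto
    show "\<exists>r'. strict_mono r' \<and> P n (s \<circ> r')"
    proof (intro exI conjI)
      \<comment> \<open>The shift by \<open>N\<close>, which discards the functions not yet known to
        be holomorphic on this ball, is absorbed into the subsequence.\<close>
      show "strict_mono (\<lambda>k. q k + N)" using g(2) by (simp add: strict_mono_def)
      show "P n (s \<circ> (\<lambda>k. q k + N))" unfolding P_def
        using g(1,3) by (auto simp: o_def)
    qed
  qed
  have P: "P n diagseq" for n
  proof -
    \<comment> \<open>Only from index \<open>Suc n\<close> on is the diagonal sequence known to
      inherit the property of stage \<open>n\<close>; \<open>uniform_limit_shift\<close> removes the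
      offset afterwards.\<close>
    have "P n (diagseq \<circ> ((+) (Suc n)))"
    proof (rule diagseq_holds)
      fix q s :: "nat \<Rightarrow> nat" and m assume q: "strict_mono q" and "P m s"
      then obtain g where g: "g holomorphic_on ball 0 (r m)"
        "\<And>K. compact K \<Longrightarrow> K \<subseteq> ball 0 (r m) \<Longrightarrow> uniform_limit K (F \<circ> s) g sequentially"
        unfolding P_def by blast
      have "uniform_limit K (F \<circ> (s \<circ> q)) g sequentially" if "compact K" "K \<subseteq> ball 0 (r m)" for K
        using filterlim_compose[OF g(2)[OF that] filterlim_subseq[OF q]] by (simp add: o_def)
      with g(1) show "P m (s \<circ> q)" unfolding P_def by blast
    qed
    then obtain g where g: "g holomorphic_on ball 0 (r n)"
      "\<And>K. compact K \<Longrightarrow> K \<subseteq> ball 0 (r n) \<Longrightarrow> uniform_limit K (F \<circ> (diagseq \<circ> (+) (Suc n))) g sequentially"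
      unfolding P_def by blast
    have "uniform_limit K (F \<circ> diagseq) g sequentially" if "compact K" "K \<subseteq> ball 0 (r n)" for K
      using g(2)[OF that] by (rule_tac uniform_limit_shift[where N="Suc n"]) (simp add: o_def add.commute)
    with g(1) show ?thesis unfolding P_def by blast
  qed
  then have "\<exists>g. \<forall>n. g n holomorphic_on ball 0 (r n) \<and>
      (\<forall>K. compact K \<longrightarrow> K \<subseteq> ball 0 (r n) \<longrightarrow> uniform_limit K (F \<circ> diagseq) (g n) sequentially)"
    unfolding P_def by (intro choice) blast
  then obtain g where g: "\<And>n. g n holomorphic_on ball 0 (r n)"
      "\<And>n K. compact K \<Longrightarrow> K \<subseteq> ball 0 (r n) \<Longrightarrow> uniform_limit K (F \<circ> diagseq) (g n) sequentially"
    by blast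
  \<comment> \<open>Being a pointwise limit, \<open>G\<close> agrees with every local limit
    \<open>g n\<close> on its ball, so these glue.\<close>
  define G where "G z = lim (\<lambda>k. F (diagseq k) z)" for z
  have Gg: "G z = g n z" if "z \<in> ball 0 (r n)" for n z
  proof -
    have "(\<lambda>k. F (diagseq k) z) \<longlonglongrightarrow> g n z"
      using tendsto_uniform_limitI[OF g(2)[of "{z}" n], of z] that by (simp add: o_def)
    then show ?thesis unfolding G_def by (rule limI)
  qed
  have ex: "\<exists>n. z \<in> ball 0 (r n)" if "z \<in> ball 0 1" for z :: complex
  proof -
    obtain n :: nat where "1 / (1 - norm z) < real n" using reals_Archimedean2 by blast
    then have "norm z < r n" using that by (simp add: r_def field_simps)
    then show ?thesis by auto
  qed
  have rmono: "r m \<le> r n" if "m \<le> n" for m n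
    using that by (auto simp: r_def field_simps)
  have "mono (\<lambda>n. ball 0 (r n) :: complex set)"
    by (intro monoI subset_ball rmono)
  moreover have "(\<Union>n. ball 0 (r n)) = (ball 0 1 :: complex set)"
    using ex r(2) by (fastforce dest: less_trans)
  ultimately have cpt: "\<exists>n. K \<subseteq> ball 0 (r n)" if "compact K" "K \<subseteq> ball 0 1" for K :: "complex set"
    using ball_exhaustion_subset[of "\<lambda>n. ball 0 (r n)" K] that by (metis open_ball order_refl)
  show ?thesis
  proof
    show "strict_mono diagseq" by (rule subseq_diagseq)
    have "G field_differentiable (at z)" if z: "z \<in> ball 0 1" for z
    proof -
      obtain n where n: "z \<in> ball 0 (r n)" using ex[OF z] by blast
      have "G holomorphic_on ball 0 (r n)"
        using g(1)[of n] Gg holomorphic_cong by (metis (no_types, lifting))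
      then show ?thesis using n by (meson holomorphic_on_imp_differentiable_at open_ball)
    qed
    then show "G holomorphic_on ball 0 1"
      by (auto simp: holomorphic_on_def intro: field_differentiable_at_within)
    fix K :: "complex set" assume K: "compact K" "K \<subseteq> ball 0 1"
    then obtain n where n: "K \<subseteq> ball 0 (r n)" using cpt by blast
    show "uniform_limit K (F \<circ> diagseq) G sequentially"
      using g(2)[OF K(1) n] Gg n by (subst uniform_limit_cong'[where g="F \<circ> diagseq" and i = "g n"]) auto
  qed
qed

section \<open>Coverings of Riemann surfaces by plane domains\<close>

lemma covering_map_sheets:
  assumes "covering_map (top_of_set B) X p" "open B" "x \<in> topspace X"
  obtains U \<V> where "openin X U" "x \<in> U" "\<Union>\<V> = B \<inter> p -` U" "pairwise disjnt \<V>"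
    "\<And>V. V \<in> \<V> \<Longrightarrow> open V \<and> V \<subseteq> B \<and> inj_on p V \<and> p ` V = U"
proof -
  obtain U \<V> where U: "openin X U" "x \<in> U" "\<Union>\<V> = B \<inter> p -` U" "pairwise disjnt \<V>"
    and o: "\<And>V. V \<in> \<V> \<Longrightarrow> openin (top_of_set B) V"
    and hm: "\<And>V. V \<in> \<V> \<Longrightarrow> homeomorphic_map (subtopology (top_of_set B) V) (subtopology X U) p"
    using assms(1,3) unfolding covering_map_def topspace_euclidean_subtopology by meson
  have "open V \<and> V \<subseteq> B \<and> inj_on p V \<and> p ` V = U" if V: "V \<in> \<V>" for V
  proof -
    have VB: "open V" "V \<subseteq> B" using o[OF V] assms(2) openin_open_trans openin_imp_subset by blast+
    have "B \<inter> V = V" "topspace X \<inter> U = U" using VB openin_subset[OF U(1)] by auto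
    then show ?thesis
      using VB homeomorphic_imp_injective_map[OF hm[OF V]] homeomorphic_imp_surjective_map[OF hm[OF V]]
      by (simp add: topspace_subtopology)
  qed
  then show ?thesis by (rule that[OF U])
qed

lemma covering_map_locally_injective:
  assumes "covering_map (top_of_set B) X p" "open B" "u \<in> B"
  obtains N where "open N" "u \<in> N" "N \<subseteq> B" "inj_on p N"
proof -
  have "p u \<in> topspace X" using assms(1,3) unfolding covering_map_def by auto
  then obtain U \<V> where U: "p u \<in> U" "\<Union>\<V> = B \<inter> p -` U"
    "\<And>V. V \<in> \<V> \<Longrightarrow> open V \<and> V \<subseteq> B \<and> inj_on p V \<and> p ` V = U"
    using covering_map_sheets[OF assms(1,2)] by metis
  then obtain V where V: "V \<in> \<V>" "u \<in> V" using assms(3) by blast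
  show ?thesis using that[of V] U(3)[OF V(1)] V(2) by simp
qed

lemma riemann_surface_chart:
  assumes "riemann_surface X At" "(U, \<phi>) \<in> At"
  shows "openin X U" "inj_on \<phi> U"
proof -
  have c: "chart X U \<phi>" using assms unfolding riemann_surface_def by blast
  then show o: "openin X U" by (simp add: chart_def)
  have "inj_on \<phi> (topspace (subtopology X U))"
    using c unfolding chart_def by (metis homeomorphic_imp_injective_map)
  moreover have "topspace (subtopology X U) = U"
    using openin_subset[OF o] by (auto simp: topspace_subtopology)
  ultimately show "inj_on \<phi> U" by simp
qed

lemma riemann_surface_chart_at:
  assumes "riemann_surface X At" "x \<in> topspace X"
  obtains U \<phi> where "(U, \<phi>) \<in> At" "x \<in> U"
proof -
  have "x \<in> \<Union>(fst ` At)" using assms unfolding riemann_surface_def by (elim conjE) (rule subsetD)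
  then obtain c where "c \<in> At" "x \<in> fst c" by blast
  then show ?thesis using that[of "fst c" "snd c"] by simp
qed

lemma open_preimage:
  assumes "holo_into X At B p" "openin X U"
  shows "open (B \<inter> p -` U)"
proof -
  have "openin (top_of_set B) {x \<in> topspace (top_of_set B). p x \<in> U}"
    using assms openin_continuous_map_preimage unfolding holo_into_def by blast
  then have "openin (top_of_set B) (B \<inter> p -` U)" by (simp add: vimage_def Int_def)
  then show ?thesis using assms(1) openin_open_trans unfolding holo_into_def by blast
qed

lemma holomorphic_on_open_local:
  assumes "\<And>z. z \<in> S \<Longrightarrow> \<exists>V. open V \<and> z \<in> V \<and> f holomorphic_on V"
  shows "f holomorphic_on S"
  unfolding holomorphic_on_def
proof
  fix z assume "z \<in> S"
  then obtain V where "open V" "z \<in> V" "f holomorphic_on V" using assms by blast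
  then have "f field_differentiable at z" by (rule_tac holomorphic_on_imp_differentiable_at)
  then show "f field_differentiable at z within S" by (rule field_differentiable_at_within)
qed

text \<open>Near a point this is \<open>f\<close> read in a chart composed with \<open>p\<close>
  read in the same chart, and holomorphy is local.\<close>

lemma holo_fun_pullback:
  assumes rs: "riemann_surface X At" and p: "holo_into X At B p" and f: "holo_fun X At W f"
  shows "(f \<circ> p) holomorphic_on (B \<inter> p -` W)"
proof (rule holomorphic_on_open_local)
  fix u assume u: "u \<in> B \<inter> p -` W"
  have W: "openin X W" using f by (simp add: holo_fun_def)
  then have "p u \<in> topspace X" using u openin_subset by blast
  then obtain U \<phi> where U: "(U, \<phi>) \<in> At" "p u \<in> U" using riemann_surface_chart_at[OF rs] by blast
  note ch = riemann_surface_chart[OF rs U(1)]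
  define V where "V = B \<inter> p -` (U \<inter> W)"
  have "open V" unfolding V_def by (intro open_preimage[OF p] openin_Int ch W)
  have h1: "(\<phi> \<circ> p) holomorphic_on V"
    using p U(1) unfolding holo_into_def V_def by (force intro: holomorphic_on_subset)
  have h2: "(f \<circ> inv_into U \<phi>) holomorphic_on (\<phi> ` (U \<inter> W))"
    using f U(1) unfolding holo_fun_def by blast
  have "((f \<circ> inv_into U \<phi>) \<circ> (\<phi> \<circ> p)) holomorphic_on V"
    by (rule holomorphic_on_compose_gen[OF h1 h2]) (auto simp: V_def)
  then have "(f \<circ> p) holomorphic_on V"
    by (rule holomorphic_transform) (use ch(2) in \<open>auto simp: V_def\<close>)
  then show "\<exists>V. open V \<and> u \<in> V \<and> (f \<circ> p) holomorphic_on V"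
    using \<open>open V\<close> u U(2) by (intro exI[of _ V]) (auto simp: V_def)
qed

text \<open>The sheets of \<open>p\<close> over \<open>U\<close>, cut down to the preimage of
  \<open>W\<close>, are the sheets of \<open>f \<circ> p\<close> over the image of
  \<open>U \<inter> W\<close>. This moves the covering from the abstract surface into the plane,
  where the lifting theorems apply.\<close>

lemma covering_space_pullback:
  assumes rs: "riemann_surface X At" and p: "holo_into X At B p" and cov: "covering_map (top_of_set B) X p"
    and f: "biholo X At W \<Omega> f"
  shows "covering_space (B \<inter> p -` W) (f \<circ> p) \<Omega>"
proof -
  let ?S = "B \<inter> p -` W"
  have hf: "holo_fun X At W f" and bij: "bij_betw f W \<Omega>" and hi: "holo_into X At \<Omega> (inv_into W f)"
    using f unfolding biholo_def by blast+
  have oW: "openin X W" using hf by (simp add: holo_fun_def)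
  have oB: "open B" using p by (simp add: holo_into_def)
  have pB: "p ` B = topspace X" using cov by (simp add: covering_map_def)
  have hol: "(f \<circ> p) holomorphic_on ?S" by (rule holo_fun_pullback[OF rs p hf])
  have oS: "open ?S" by (rule open_preimage[OF p oW])
  have inj: "inj_on f W" using bij by (simp add: bij_betw_def)
  have fW: "f ` W = \<Omega>" using bij by (simp add: bij_betw_def)
  have im: "(f \<circ> p) ` ?S = \<Omega>"
  proof -
    have "p ` ?S = W"
    proof
      show "W \<subseteq> p ` ?S"
      proof
        fix y assume y: "y \<in> W"
        then have "y \<in> p ` B" using openin_subset[OF oW] pB by blast
        then show "y \<in> p ` ?S" using y by blast
      qed
    qed blast
    then show ?thesis using fW by (metis image_comp)
  qed
  have sheets: "\<exists>T. x \<in> T \<and> openin (top_of_set \<Omega>) T \<and>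
      (\<exists>v. \<Union>v = ?S \<inter> (f \<circ> p) -` T \<and> (\<forall>u\<in>v. openin (top_of_set ?S) u) \<and> pairwise disjnt v \<and>
        (\<forall>u\<in>v. \<exists>q. homeomorphism u T (f \<circ> p) q))" if x: "x \<in> \<Omega>" for x
  proof -
    obtain y where y: "y \<in> W" "f y = x" using x fW by blast
    then have "y \<in> topspace X" using openin_subset[OF oW] by blast
    then obtain U \<V> where U: "openin X U" "y \<in> U" "\<Union>\<V> = B \<inter> p -` U" "pairwise disjnt \<V>"
      "\<And>V. V \<in> \<V> \<Longrightarrow> open V \<and> V \<subseteq> B \<and> inj_on p V \<and> p ` V = U"
      using covering_map_sheets[OF cov oB] by metis
    define T where "T = f ` (U \<inter> W)"
    have "T = \<Omega> \<inter> inv_into W f -` (U \<inter> W)"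
      unfolding T_def fW[symmetric] using inj by (auto simp: inv_into_f_f)
    then have oT: "open T" using open_preimage[OF hi openin_Int[OF U(1) oW]] by simp
    define v where "v = (\<lambda>V. V \<inter> p -` W) ` \<V>"
    have vo: "open u" "u \<subseteq> ?S" if "u \<in> v" for u
    proof -
      obtain V where V: "V \<in> \<V>" "u = V \<inter> p -` W" using \<open>u \<in> v\<close> v_def by blast
      then have "u = V \<inter> ?S" using U(5)[OF V(1)] by blast
      then show "open u" "u \<subseteq> ?S" using oS U(5)[OF V(1)] by auto
    qed
    have v1: "\<Union>v = ?S \<inter> (f \<circ> p) -` T"
    proof -
      have "\<Union>v = \<Union>\<V> \<inter> p -` W" by (auto simp: v_def)
      also have "\<dots> = ?S \<inter> p -` U" using U(3) by auto
      also have "\<dots> = ?S \<inter> (f \<circ> p) -` T"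
      proof -
        have "x \<in> U \<longleftrightarrow> f x \<in> T" if "x \<in> W" for x
          unfolding T_def using inj that by (auto dest: inj_onD)
        then show ?thesis by auto
      qed
      finally show ?thesis .
    qed
    have v2: "pairwise disjnt v"
      unfolding v_def
    proof (rule pairwise_imageI)
      fix A C assume "A \<in> \<V>" "C \<in> \<V>" "A \<noteq> C"
      then have "disjnt A C" using U(4) by (simp add: pairwise_def)
      then show "disjnt (A \<inter> p -` W) (C \<inter> p -` W)" by (auto simp: disjnt_def)
    qed
    have v3: "\<exists>q. homeomorphism u T (f \<circ> p) q" if uv: "u \<in> v" for u
    proof -
      obtain V where V: "V \<in> \<V>" "u = V \<inter> p -` W" using uv v_def by blast
      have i: "inj_on (f \<circ> p) u"
        using U(5)[OF V(1)] inj unfolding V(2) inj_on_def by auto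
      have "p ` u = U \<inter> W" using U(5)[OF V(1)] V(2) by blast
      then have iT: "(f \<circ> p) ` u = T" unfolding T_def by (metis image_comp)
      have hu: "(f \<circ> p) holomorphic_on u" using hol vo[OF uv] holomorphic_on_subset by blast
      \<comment> \<open>The continuous inverse on a sheet comes from complex analysis: an injective
        holomorphic map on an open set has a holomorphic inverse.\<close>
      obtain k where k: "k holomorphic_on ((f \<circ> p) ` u)" "\<And>z. z \<in> u \<Longrightarrow> k ((f \<circ> p) z) = z"
        using holomorphic_has_inverse[OF hu vo(1)[OF uv] i] by metis
      have "homeomorphism u T (f \<circ> p) k"
      proof (rule homeomorphismI)
        show "continuous_on u (f \<circ> p)" by (rule holomorphic_on_imp_continuous_on[OF hu])
        show "continuous_on T k" using holomorphic_on_imp_continuous_on[OF k(1)] iT by simp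
      qed (use k(2) in \<open>auto simp flip: iT\<close>)
      then show ?thesis by blast
    qed
    have v4: "openin (top_of_set ?S) u" if "u \<in> v" for u
      using vo[OF that] by (intro open_subset)
    have T1: "openin (top_of_set \<Omega>) T"
      using oT fW by (auto simp: T_def intro!: open_subset)
    have T2: "x \<in> T" using y U(2) by (auto simp: T_def)
    show ?thesis by (intro exI[of _ T] exI[of _ v] conjI ballI T1 T2 v1 v2 v3 v4)
  qed
  show ?thesis
    unfolding covering_space_def
    by (intro conjI ballI holomorphic_on_imp_continuous_on[OF hol] im sheets)
qed

text \<open>Equal fibres let \<open>F\<close> descend to a bijection onto \<Omega>. Both
  \<open>p\<close> and \<open>F\<close> are locally injective, and local sections of them show that
  the bijection and its inverse are holomorphic. It serves with \<open>F = G\<close> for the target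
  \<Omega> and with \<open>F = id\<close> for the disc.\<close>

lemma biholo_if_same_fibres:
  assumes rs: "riemann_surface X At" and p: "holo_into X At B p" and cov: "covering_map (top_of_set B) X p"
    and F: "F holomorphic_on B" "F ` B = \<Omega>" "open \<Omega>"
    and fib: "\<And>u v. u \<in> B \<Longrightarrow> v \<in> B \<Longrightarrow> F u = F v \<longleftrightarrow> p u = p v"
  shows "\<exists>f. biholo X At (topspace X) \<Omega> f"
proof -
  define f where "f x = F (inv_into B p x)" for x
  have oB: "open B" using p by (simp add: holo_into_def)
  have pB: "p ` B = topspace X" using cov by (simp add: covering_map_def)
  have fp: "f (p u) = F u" if "u \<in> B" for u
    using fib[of "inv_into B p (p u)" u] that by (auto simp: f_def inv_into_into f_inv_into_f)
  have bij: "bij_betw f (topspace X) \<Omega>"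
    unfolding bij_betw_def
  proof
    show "inj_on f (topspace X)"
    proof (rule inj_onI)
      fix x y assume "x \<in> topspace X" "y \<in> topspace X" and eq: "f x = f y"
      then obtain u v where "u \<in> B" "v \<in> B" "x = p u" "y = p v" using pB by blast
      then show "x = y" using eq fp fib by metis
    qed
    show "f ` topspace X = \<Omega>" using fp F(2) unfolding pB[symmetric] image_image by simp
  qed
  let ?g = "inv_into (topspace X) f"
  have gF: "?g (F u) = p u" if "u \<in> B" for u
    using bij that fp[OF that] pB by (metis bij_betw_imp_inj_on imageI inv_into_f_f)
  have loc: "\<exists>N. open N \<and> u \<in> N \<and> N \<subseteq> B \<and> inj_on p N \<and> inj_on F N" if u: "u \<in> B" for u
  proof -
    obtain N where N: "open N" "u \<in> N" "N \<subseteq> B" "inj_on p N"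
      using covering_map_locally_injective[OF cov oB u] by blast
    then have "inj_on F N" using fib unfolding inj_on_def by (meson subsetD)
    with N show ?thesis by blast
  qed
  have hf: "holo_fun X At (topspace X) f"
    unfolding holo_fun_def
  proof (intro conjI openin_topspace ballI, clarify)
    fix U \<phi> assume U: "(U, \<phi>) \<in> At"
    note ch = riemann_surface_chart[OF rs U]
    show "(f \<circ> inv_into U \<phi>) holomorphic_on \<phi> ` (U \<inter> topspace X)"
    proof (rule holomorphic_on_open_local)
      fix y assume "y \<in> \<phi> ` (U \<inter> topspace X)"
      then obtain x where x: "x \<in> U" "x \<in> p ` B" "y = \<phi> x" unfolding pB by blast
      then obtain u where u: "u \<in> B" "p u \<in> U" "y = \<phi> (p u)" by blast
      obtain N where N: "open N" "u \<in> N" "N \<subseteq> B" "inj_on p N" using loc[OF u(1)] by blast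
      define N' where "N' = N \<inter> (B \<inter> p -` U)"
      have N': "open N'" "u \<in> N'" "N' \<subseteq> B \<inter> p -` U"
        using N u open_preimage[OF p ch(1)] by (auto simp: N'_def)
      have h: "(\<phi> \<circ> p) holomorphic_on N'"
        using p U N'(3) unfolding holo_into_def by (force intro: holomorphic_on_subset)
      have i: "inj_on (\<phi> \<circ> p) N'"
        using N(4) ch(2) unfolding N'_def inj_on_def by auto
      obtain V k where k: "open V" "(\<phi> \<circ> p) u \<in> V" "k holomorphic_on V" "k ` V \<subseteq> N'"
        "\<And>w. w \<in> V \<Longrightarrow> (\<phi> \<circ> p) (k w) = w"
        using holomorphic_local_inverse[OF h N'(1) i N'(2)] by metis
      \<comment> \<open>As \<open>k\<close> is a local section of \<open>\<phi> \<circ> p\<close>,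
        the map \<open>f\<close> reads \<open>F \<circ> k\<close> in the chart.\<close>
      have "(F \<circ> k) holomorphic_on V"
        using k(4) N'(3) by (intro holomorphic_on_compose_gen[OF k(3) F(1)]) auto
      then have "(f \<circ> inv_into U \<phi>) holomorphic_on V"
      proof (rule holomorphic_transform)
        fix w assume w: "w \<in> V"
        then have kw: "k w \<in> B" "p (k w) \<in> U" using k(4) N'(3) by auto
        have "inv_into U \<phi> w = p (k w)"
          using k(5)[OF w] ch(2) kw(2) by (metis comp_apply inv_into_f_f)
        then show "(F \<circ> k) w = (f \<circ> inv_into U \<phi>) w" using fp[OF kw(1)] by simp
      qed
      then show "\<exists>V. open V \<and> y \<in> V \<and> (f \<circ> inv_into U \<phi>) holomorphic_on V"
        using k(1,2) u(3) by auto
    qed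
  qed
  \<comment> \<open>Dually, the inverse of \<open>f\<close> is locally \<open>p \<circ> k\<close>
    for a local section \<open>k\<close> of \<open>F\<close>.\<close>
  have lift: "\<exists>V k. open V \<and> y \<in> V \<and> k holomorphic_on V \<and> k ` V \<subseteq> B \<and> (\<forall>w\<in>V. F (k w) = w \<and> ?g w = p (k w)) \<and> V \<subseteq> \<Omega>"
    if y: "y \<in> \<Omega>" for y
  proof -
    obtain u where u: "u \<in> B" "y = F u" using y F(2) by blast
    obtain N where N: "open N" "u \<in> N" "N \<subseteq> B" "inj_on F N" using loc[OF u(1)] by blast
    have h: "F holomorphic_on N" using F(1) N(3) holomorphic_on_subset by blast
    obtain V k where k: "open V" "F u \<in> V" "k holomorphic_on V" "k ` V \<subseteq> N"
      "\<And>w. w \<in> V \<Longrightarrow> F (k w) = w"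
      using holomorphic_local_inverse[OF h N(1,4,2)] by metis
    have "?g w = p (k w)" if "w \<in> V" for w
    proof -
      have "k w \<in> B" using k(4) N(3) that by blast
      then show ?thesis using gF[of "k w"] k(5)[OF that] by simp
    qed
    moreover have "V \<subseteq> \<Omega>" using k(4,5) N(3) F(2) by (metis image_subset_iff subset_iff imageI)
    ultimately show ?thesis using k N(3) u(2) by (intro exI[of _ V] exI[of _ k]) auto
  qed
  have preim: "open (\<Omega> \<inter> ?g -` U)" if U: "openin X U" for U
  proof (subst open_subopen, intro ballI)
    fix y assume y: "y \<in> \<Omega> \<inter> ?g -` U"
    obtain V k where k: "open V" "y \<in> V" "k holomorphic_on V" "k ` V \<subseteq> B"
      "\<And>w. w \<in> V \<Longrightarrow> ?g w = p (k w)" "V \<subseteq> \<Omega>"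
      using lift[of y] y by blast
    have "open (V \<inter> k -` (B \<inter> p -` U))"
      using k(3,1) open_preimage[OF p U] holomorphic_on_imp_continuous_on continuous_open_preimage by blast
    moreover have "y \<in> V \<inter> k -` (B \<inter> p -` U)" using k y by auto
    moreover have "V \<inter> k -` (B \<inter> p -` U) \<subseteq> \<Omega> \<inter> ?g -` U" using k by auto
    ultimately show "\<exists>T. open T \<and> y \<in> T \<and> T \<subseteq> \<Omega> \<inter> ?g -` U" by blast
  qed
  have hi: "holo_into X At \<Omega> ?g"
    unfolding holo_into_def
  proof (intro conjI ballI, goal_cases)
    case 1 show ?case by (rule F(3))
  next
    case 2
    show ?case unfolding continuous_map_def
    proof (intro conjI allI impI)
      show "?g \<in> topspace (top_of_set \<Omega>) \<rightarrow> topspace X"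
        using bij by (auto simp: bij_betw_def inv_into_into)
      fix U assume "openin X U"
      then have "open (\<Omega> \<inter> ?g -` U)" by (rule preim)
      then show "openin (top_of_set \<Omega>) {x \<in> topspace (top_of_set \<Omega>). ?g x \<in> U}"
        by (auto simp: Int_def vimage_def intro!: open_subset)
    qed
  next
    case (3 c)
    obtain U \<phi> where c: "c = (U, \<phi>)" by (cases c)
    note ch = riemann_surface_chart[OF rs 3[unfolded c]]
    have "(\<phi> \<circ> ?g) holomorphic_on (\<Omega> \<inter> ?g -` U)"
    proof (rule holomorphic_on_open_local)
      fix y assume y: "y \<in> \<Omega> \<inter> ?g -` U"
      obtain V k where k: "open V" "y \<in> V" "k holomorphic_on V" "k ` V \<subseteq> B"
        "\<And>w. w \<in> V \<Longrightarrow> ?g w = p (k w)" "V \<subseteq> \<Omega>"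
        using lift[of y] y by blast
      define V' where "V' = V \<inter> (\<Omega> \<inter> ?g -` U)"
      have V': "open V'" "y \<in> V'" using k y preim[OF ch(1)] by (auto simp: V'_def)
      have h: "(\<phi> \<circ> p) holomorphic_on (B \<inter> p -` U)"
        using p 3[unfolded c] unfolding holo_into_def by blast
      have "k holomorphic_on V'" using k(3) V'_def holomorphic_on_subset by blast
      then have "((\<phi> \<circ> p) \<circ> k) holomorphic_on V'"
        by (rule holomorphic_on_compose_gen[OF _ h]) (use k V'_def in auto)
      then have "(\<phi> \<circ> ?g) holomorphic_on V'"
        by (rule holomorphic_transform) (use k(5) V'_def in auto)
      then show "\<exists>V. open V \<and> y \<in> V \<and> (\<phi> \<circ> ?g) holomorphic_on V" using V' by blast
    qed
    then show ?case by (simp add: c)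
  qed
  show ?thesis using hf bij hi unfolding biholo_def by blast
qed

section \<open>Limits of coverings on an exhaustion of the disc\<close>

text \<open>Of the surface only the projection \<pi> is kept, and of \<pi> only its fibres matter.
  \<open>S j\<close> stands for the preimage of the \<open>j\<close>-th piece, \<open>F j\<close>
  for the covering of \<Omega> that its biholomorphism induces.\<close>

locale covering_exhaustion =
  fixes S :: "nat \<Rightarrow> complex set" and F :: "nat \<Rightarrow> complex \<Rightarrow> complex" and \<Omega> :: "complex set"
    and \<pi> :: "complex \<Rightarrow> 'a"
  assumes open_S: "\<And>j. open (S j)" and mono_S: "mono S" and Union_S: "(\<Union>j. S j) = ball 0 1"
    and holo_F: "\<And>j. F j holomorphic_on S j" and cov_F: "\<And>j. covering_space (S j) (F j) \<Omega>"
    and fibre: "\<And>j u v. u \<in> S j \<Longrightarrow> v \<in> S j \<Longrightarrow> F j u = F j v \<longleftrightarrow> \<pi> u = \<pi> v"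
    and saturated: "\<And>j u v. u \<in> S j \<Longrightarrow> v \<in> ball 0 1 \<Longrightarrow> \<pi> u = \<pi> v \<Longrightarrow> v \<in> S j"
begin

lemma S_subset: "S j \<subseteq> ball 0 1"
  using Union_S by blast

lemma norm_S: "z \<in> S j \<Longrightarrow> norm z < 1"
  using S_subset by fastforce

lemma F_in: "z \<in> S j \<Longrightarrow> F j z \<in> \<Omega>"
  using cov_F[of j] by (auto simp: covering_space_def)

lemma cont_F: "continuous_on (S j) (F j)"
  using holo_F holomorphic_on_imp_continuous_on by blast

lemma subset_S:
  assumes "compact K" "K \<subseteq> ball 0 1"
  shows "\<forall>\<^sub>F n in sequentially. K \<subseteq> S n"
  unfolding eventually_sequentially
  by (rule ball_exhaustion_subset[OF open_S mono_S Union_S assms]) auto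

lemma eventually_in_S: "z \<in> ball 0 1 \<Longrightarrow> \<forall>\<^sub>F n in sequentially. z \<in> S n"
  using subset_S[of "{z}"] by simp

text \<open>\<open>g \<circ> L\<close> and the identity both lift \<open>F n\<close> through the
  covering \<open>F n\<close> and agree at \<open>u\<close>, so uniqueness of lifts applies. In the
  uses, \<open>L\<close> is \<open>F n\<close> itself or a logarithm of
  \<open>F n - p\<close>.\<close>

lemma lift_cancel:
  assumes "connected T" "T \<subseteq> S n" "u \<in> T" "continuous_on T L" "L \<in> T \<rightarrow> U" "continuous_on U g"
    "g \<in> U \<rightarrow> S n" "g (L u) = u" "\<And>z. z \<in> T \<Longrightarrow> F n (g (L z)) = F n z" "z \<in> T"
  shows "g (L z) = z"
proof (rule covering_space_lift_unique[OF cov_F[of n], where f = "F n" and T = T and a = u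
      and ?g1.0 = "\<lambda>z. g (L z)" and ?g2.0 = "\<lambda>z. z"])
  show "continuous_on T (F n)" using cont_F assms(2) continuous_on_subset by blast
  show "continuous_on T (\<lambda>z. g (L z))"
    using assms(4,5,6) by (auto intro: continuous_on_compose2)
qed (use assms F_in in \<open>auto simp: continuous_on_id\<close>)

lemma lift_ball:
  assumes "ball q R \<subseteq> \<Omega>" "u \<in> S n" "F n u \<in> ball q R"
  obtains g where "g holomorphic_on ball q R" "g \<in> ball q R \<rightarrow> S n" "g (F n u) = u"
    "\<And>y. y \<in> ball q R \<Longrightarrow> F n (g y) = y"
proof -
  obtain g where "g holomorphic_on ball q R" "g \<in> ball q R \<rightarrow> S n" "g (F n u) = u"
    "\<And>y. y \<in> ball q R \<Longrightarrow> F n (g y) = id y"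
    by (rule covering_space_holomorphic_lift_at[OF cov_F open_S holo_F assms(2,3), of id])
       (use assms(1) in \<open>auto simp: convex_imp_simply_connected\<close>)
  then show ?thesis using that by simp
qed

text \<open>The lifts take values in the unit disc whatever \<open>n\<close> is, so the constant
  \<open>2/R\<close> is uniform in \<open>n\<close>.\<close>

lemma lift_ball_Lipschitz:
  assumes "g holomorphic_on ball q R" "g \<in> ball q R \<rightarrow> S n" "x \<in> ball q (R/2)" "y \<in> ball q (R/2)"
  shows "norm (g x - g y) \<le> 2/R * norm (x - y)"
proof (rule holomorphic_bounded_imp_Lipschitz[OF assms(1) _ assms(3,4)])
  show "norm (g z) \<le> 1" if "z \<in> ball q R" for z
    using norm_S[of "g z" n] assms(2) that by (simp add: Pi_iff)
qed

end

locale convergent_covering_exhaustion = covering_exhaustion S F \<Omega> \<pi>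
  for S F \<Omega> and \<pi> :: "complex \<Rightarrow> 'a" +
  fixes G :: "complex \<Rightarrow> complex"
  assumes open_\<Omega>: "open \<Omega>" and connected_\<Omega>: "connected \<Omega>" and holo_G: "G holomorphic_on ball 0 1"
    and lim_G: "\<And>K. \<lbrakk>compact K; K \<subseteq> ball 0 1\<rbrakk> \<Longrightarrow> uniform_limit K F G sequentially"
begin

lemma tendsto_G: "z \<in> ball 0 1 \<Longrightarrow> (\<lambda>n. F n z) \<longlonglongrightarrow> G z"
  using tendsto_uniform_limitI[OF lim_G[of "{z}"], of z] by simp

lemma cont_G: "continuous_on (ball 0 1) G"
  using holo_G holomorphic_on_imp_continuous_on by blast

lemma G_closure:
  assumes "z \<in> ball 0 1"
  shows "G z \<in> closure \<Omega>"
proof (rule Lim_in_closed_set)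
  show "\<forall>\<^sub>F n in sequentially. F n z \<in> closure \<Omega>"
    using eventually_in_S[OF assms] by eventually_elim (use F_in closure_subset in blast)
  show "(\<lambda>n. F n z) \<longlonglongrightarrow> G z" by (rule tendsto_G[OF assms])
qed auto

lemma G_fibre:
  assumes "u \<in> ball 0 1" "v \<in> ball 0 1" "\<pi> u = \<pi> v"
  shows "G u = G v"
proof (rule LIMSEQ_unique)
  show "(\<lambda>n. F n u) \<longlonglongrightarrow> G u" by (rule tendsto_G[OF assms(1)])
  have "\<forall>\<^sub>F n in sequentially. F n u = F n v"
    using eventually_in_S[OF assms(1)] eventually_in_S[OF assms(2)]
    by eventually_elim (use fibre assms(3) in blast)
  then show "(\<lambda>n. F n u) \<longlonglongrightarrow> G v"
    using tendsto_cong[of "\<lambda>n. F n u" "\<lambda>n. F n v"] tendsto_G[OF assms(2)] by simp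
qed

text \<open>Hurwitz's theorem for \<open>F n - c\<close>, which has no zeros because
  \<open>F n\<close> maps into \<Omega>. The radius \<open>r < 1\<close> and a shift by
  \<open>N\<close> put all functions on one domain.\<close>

lemma G_omits:
  assumes r: "0 < r" "r < 1" and c: "c \<notin> \<Omega>" and nc: "\<not> G constant_on ball 0 r" and z: "z \<in> ball 0 r"
  shows "G z \<noteq> c"
proof -
  have "\<forall>\<^sub>F n in sequentially. cball 0 r \<subseteq> S n" using r by (intro subset_S) auto
  then obtain N where N: "\<And>n. n \<ge> N \<Longrightarrow> cball 0 r \<subseteq> S n" by (auto simp: eventually_sequentially)
  have sub: "ball 0 r \<subseteq> S (n + N)" for n using N[of "n+N"] by auto
  have br: "ball 0 r \<subseteq> (ball 0 1 :: complex set)" using r by auto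
  have "G z - c \<noteq> 0"
  proof (rule Hurwitz_no_zeros[of "ball 0 r" "\<lambda>n z. F (n + N) z - c" "\<lambda>z. G z - c" z])
    show "(\<lambda>z. F (n + N) z - c) holomorphic_on ball 0 r" for n
      using holomorphic_on_subset[OF holo_F sub] by (intro holomorphic_intros)
    show "(\<lambda>z. G z - c) holomorphic_on ball 0 r"
      using holomorphic_on_subset[OF holo_G br] by (intro holomorphic_intros)
    show "\<not> (\<lambda>z. G z - c) constant_on ball 0 r"
    proof
      assume "(\<lambda>z. G z - c) constant_on ball 0 r"
      then obtain d where "\<And>z. z \<in> ball 0 r \<Longrightarrow> G z - c = d" by (auto simp: constant_on_def)
      then have "\<And>z. z \<in> ball 0 r \<Longrightarrow> G z = d + c" by (simp add: algebra_simps)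
      then show False using nc by (auto simp: constant_on_def)
    qed
    show "F (n + N) w - c \<noteq> 0" if "w \<in> ball 0 r" for n w
      using F_in[of w "n + N"] sub[of n] that c by auto
    fix K :: "complex set" assume K: "compact K" "K \<subseteq> ball 0 r"
    then have "uniform_limit K F G sequentially" using br by (intro lim_G) auto
    then have "uniform_limit K (\<lambda>n. F (n + N)) G sequentially"
      by (rule filterlim_compose[OF _ filterlim_add_const_nat_at_top])
    then show "uniform_limit K (\<lambda>n z. F (n + N) z - c) (\<lambda>z. G z - c) sequentially"
      by (intro uniform_limit_intros)
  qed (use z in auto)
  then show ?thesis by simp
qed

subsection \<open>Interior limits\<close>

text \<open>Otherwise \<open>F n\<close> would squeeze a fixed disc \<open>K\<close> into a tiny
  ball, while a section with Lipschitz constant \<open>2/R\<close> undoes \<open>F n\<close> on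
  \<open>K\<close>; \<open>K\<close> would be smaller than it is.\<close>

lemma G_not_constant:
  assumes "G 0 \<in> \<Omega>" and r: "0 < r" "r < 1"
  shows "\<not> G constant_on ball 0 r"
proof
  assume const: "G constant_on ball 0 r"
  define p where "p = G 0"
  obtain R where R: "R > 0" "ball p R \<subseteq> \<Omega>"
    using assms(1) open_\<Omega> open_contains_ball unfolding p_def by blast
  define K where "K = cball (0::complex) (r/2)"
  define z where "z = complex_of_real (r/2)"
  have K: "compact K" "K \<subseteq> ball 0 1" "0 \<in> K" "z \<in> K" "connected K" using r by (auto simp: K_def z_def)
  obtain c where c: "\<And>w. w \<in> ball 0 r \<Longrightarrow> G w = c" using const by (auto simp: constant_on_def)
  have Gp: "G w = p" if "w \<in> K" for w
    using c[of w] c[of 0] that r by (simp add: p_def K_def)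
  have *: "\<forall>\<^sub>F n in sequentially. \<forall>w\<in>K. dist (F n w) p < e" if "e > 0" for e
    using lim_G[OF K(1,2)] that Gp by (simp add: uniform_limit_iff)
  \<comment> \<open>\<open>R/2\<close> brings the values into the half ball of the Lipschitz bound;
    \<open>R * r / 16\<close> gives \<open>2/R * 2e \<le> r/4\<close>, below the norm
    \<open>r/2\<close> of \<open>z\<close>.\<close>
  define e where "e = min (R/2) (R * r / 16)"
  have "e > 0" using R r by (auto simp: e_def)
  obtain n where n: "\<And>w. w \<in> K \<Longrightarrow> dist (F n w) p < e" "K \<subseteq> S n"
    using eventually_happens[OF eventually_conj[OF *[OF \<open>e > 0\<close>] subset_S[OF K(1,2)]]] by auto
  have in2: "F n w \<in> ball p (R/2)" if "w \<in> K" for w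
    using n(1)[OF that] by (auto simp: e_def dist_commute)
  then have in1: "F n w \<in> ball p R" if "w \<in> K" for w
    using that R(1) by force
  obtain g where g: "g holomorphic_on ball p R" "g \<in> ball p R \<rightarrow> S n" "g (F n 0) = 0"
    "\<And>y. y \<in> ball p R \<Longrightarrow> F n (g y) = y"
    using lift_ball[OF R(2), of 0 n] in1 K n(2) by blast
  have "g (F n z) = z"
  proof (rule lift_cancel[of K n 0 "F n" "ball p R"])
    show "continuous_on K (F n)" using cont_F n(2) continuous_on_subset by blast
    show "continuous_on (ball p R) g" using g(1) holomorphic_on_imp_continuous_on by blast
  qed (use K n in1 g in auto)
  then have "norm z \<le> 2/R * norm (F n z - F n 0)"
    using lift_ball_Lipschitz[OF g(1,2) in2[OF K(4)] in2[OF K(3)]] g(3) by simp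
  also have "\<dots> \<le> 2/R * (2 * (R * r / 16))"
  proof (rule mult_left_mono)
    have "norm (F n z - F n 0) \<le> 2 * e"
      using n(1)[OF K(4)] n(1)[OF K(3)] dist_triangle2[of "F n z" "F n 0" p] by (simp add: dist_norm)
    then show "norm (F n z - F n 0) \<le> 2 * (R * r / 16)" by (simp add: e_def)
  qed (use R in simp)
  also have "\<dots> = r/4" using R by simp
  finally show False using R r by (simp add: z_def)
qed

lemma G_in:
  assumes "G 0 \<in> \<Omega>" "z \<in> ball 0 1"
  shows "G z \<in> \<Omega>"
proof -
  obtain r where r: "norm z < r" "r < 1" using assms(2) dense[of "norm z" 1] by auto
  then have r0: "0 < r" by (meson norm_ge_zero le_less_trans)
  show ?thesis
    using G_omits[OF r0 r(2) _ G_not_constant[OF assms(1) r0 r(2)], of "G z" z] r by auto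
qed

text \<open>For the forward direction a ball about \<open>G u = G v\<close> is lifted through
  \<open>u\<close>; its lift sends \<open>F n v\<close> to a point \<open>w n\<close> of the fibre
  of \<open>v\<close>. The uniform Lipschitz bound gives
  \<open>w n \<longlonglongrightarrow> u\<close>, and continuity of a single \<open>F j\<close> puts
  \<open>u\<close> into that fibre.\<close>

lemma G_fibre_iff:
  assumes "G 0 \<in> \<Omega>" "u \<in> ball 0 1" "v \<in> ball 0 1"
  shows "G u = G v \<longleftrightarrow> \<pi> u = \<pi> v"
proof
  assume eq: "G u = G v"
  define q where "q = G u"
  obtain R where R: "R > 0" "ball q R \<subseteq> \<Omega>"
    using G_in[OF assms(1,2)] open_\<Omega> open_contains_ball unfolding q_def by blast
  have evu: "\<forall>\<^sub>F n in sequentially. F n u \<in> ball q (R/2)" and evv: "\<forall>\<^sub>F n in sequentially. F n v \<in> ball q (R/2)"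
    using tendstoD[OF tendsto_G[OF assms(2)], of "R/2"] tendstoD[OF tendsto_G[OF assms(3)], of "R/2"] R(1)
    by (auto simp: q_def eq dist_commute)
  have "\<forall>\<^sub>F n in sequentially. \<exists>w. norm (w - u) \<le> 2/R * norm (F n v - F n u) \<and> w \<in> ball 0 1 \<and> \<pi> w = \<pi> v"
    using evu evv eventually_in_S[OF assms(2)] eventually_in_S[OF assms(3)]
  proof eventually_elim
    case (elim n)
    then have *: "F n u \<in> ball q R" "F n v \<in> ball q R" using R(1) by auto
    obtain g where g: "g holomorphic_on ball q R" "g \<in> ball q R \<rightarrow> S n" "g (F n u) = u"
      "\<And>y. y \<in> ball q R \<Longrightarrow> F n (g y) = y"
      using lift_ball[OF R(2) elim(3) *(1)] by blast
    have "norm (g (F n v) - u) \<le> 2/R * norm (F n v - F n u)"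
      using lift_ball_Lipschitz[OF g(1,2) elim(2,1)] g(3) by simp
    moreover have "g (F n v) \<in> S n" using g(2) *(2) by auto
    moreover from this have "\<pi> (g (F n v)) = \<pi> v"
      using fibre[of "g (F n v)" n v] g(4)[OF *(2)] elim(4) by simp
    ultimately show ?case using S_subset by blast
  qed
  then obtain N where "\<forall>n\<ge>N. \<exists>w. norm (w - u) \<le> 2/R * norm (F n v - F n u) \<and> w \<in> ball 0 1 \<and> \<pi> w = \<pi> v"
    by (auto simp: eventually_sequentially)
  then obtain w where w: "\<And>n. n \<ge> N \<Longrightarrow> norm (w n - u) \<le> 2/R * norm (F n v - F n u)"
     "\<And>n. n \<ge> N \<Longrightarrow> w n \<in> ball 0 1" "\<And>n. n \<ge> N \<Longrightarrow> \<pi> (w n) = \<pi> v" by metis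
  have "(\<lambda>n. 2/R * norm (F n v - F n u)) \<longlonglongrightarrow> 2/R * norm (G v - G u)"
    by (intro tendsto_intros tendsto_G assms)
  then have "(\<lambda>n. 2/R * norm (F n v - F n u)) \<longlonglongrightarrow> 0" using eq by simp
  then have "(\<lambda>n. w n - u) \<longlonglongrightarrow> 0"
    by (rule Lim_null_comparison[rotated]) (use w(1) in \<open>auto simp: eventually_sequentially\<close>)
  then have wu: "w \<longlonglongrightarrow> u" by (simp add: LIM_zero_iff)
  \<comment> \<open>From here \<open>j\<close> is fixed: the \<open>w n\<close> enter the open set
    \<open>S j\<close>, saturation brings \<open>v\<close> along, and \<open>F j (w n)\<close> is
    eventually the constant \<open>F j v\<close>.\<close>
  obtain j where j: "u \<in> S j" using assms(2) Union_S by blast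
  have evS: "\<forall>\<^sub>F n in sequentially. w n \<in> S j"
    using topological_tendstoD[OF wu open_S j] .
  then have "\<forall>\<^sub>F n in sequentially. w n \<in> S j \<and> \<pi> (w n) = \<pi> v"
    using eventually_ge_at_top[of N] by eventually_elim (use w(3) in blast)
  moreover then have vS: "v \<in> S j"
    using saturated assms(3) by (metis (mono_tags, lifting) eventually_happens trivial_limit_sequentially)
  ultimately have "\<forall>\<^sub>F n in sequentially. F j (w n) = F j v"
    using fibre by (auto elim: eventually_mono)
  then have "(\<lambda>n. F j (w n)) \<longlonglongrightarrow> F j v" by (rule tendsto_eventually)
  moreover have "(\<lambda>n. F j (w n)) \<longlonglongrightarrow> F j u"
    using continuous_on_tendsto_compose[OF cont_F wu j evS] .
  ultimately have "F j u = F j v" using LIMSEQ_unique by blast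
  then show "\<pi> u = \<pi> v" using fibre j vS by blast
qed (use G_fibre assms in blast)

text \<open>By Schwarz--Pick, the lifts of a ball about a point near the image stay in a fixed compact
  part of the disc, so the image is relatively closed.\<close>

lemma G_image_closed:
  assumes "G 0 \<in> \<Omega>" "q \<in> \<Omega>" "q \<in> closure (G ` ball 0 1)"
  shows "q \<in> G ` ball 0 1"
proof (rule ccontr)
  assume nq: "q \<notin> G ` ball 0 1"
  obtain R where R: "R > 0" "ball q R \<subseteq> \<Omega>"
    using assms(2) open_\<Omega> open_contains_ball by blast
  obtain u where u: "u \<in> ball 0 1" "dist (G u) q < R/4"
    using assms(3) R(1) closure_approachable[of q "G ` ball 0 1"] by (metis divide_pos_pos imageE zero_less_numeral)
  \<comment> \<open>A closed hyperbolic disc about \<open>u\<close>: the Moebius map takes 0 to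
    \<open>u\<close>. It is independent of \<open>n\<close>.\<close>
  define K where "K = Moebius_function 0 (-u) ` cball 0 (1/2)"
  have u1: "norm u < 1" using u(1) by simp
  have Mh: "Moebius_function 0 w holomorphic_on ball 0 1" if "norm w < 1" for w
    using Moebius_function_holomorphic[OF that] .
  have "continuous_on (cball 0 (1/2)) (Moebius_function 0 (-u))"
    by (rule continuous_on_subset[OF holomorphic_on_imp_continuous_on[OF Mh]]) (use u1 in auto)
  then have K1: "compact K" unfolding K_def by (intro compact_continuous_image) auto
  have K2: "K \<subseteq> ball 0 1"
    unfolding K_def using Moebius_function_norm_lt_1[of "-u" _ 0] u1 by fastforce
  have "compact (G ` K)"
    using K1 K2 cont_G continuous_on_subset by (intro compact_continuous_image) auto
  moreover have "q \<notin> G ` K" using nq K2 by blast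
  ultimately obtain d where d: "d > 0" "\<And>x. x \<in> G ` K \<Longrightarrow> d \<le> dist q x"
    using separate_point_closed[of "G ` K" q] compact_imp_closed by blast
  have "\<forall>\<^sub>F n in sequentially. \<forall>x\<in>K. dist (F n x) (G x) < d"
    using lim_G[OF K1 K2] d(1) by (auto simp: uniform_limit_iff)
  moreover have "\<forall>\<^sub>F n in sequentially. dist (F n u) q < R/4"
    using order_tendstoD(2)[OF tendsto_dist[OF tendsto_G[OF u(1)] tendsto_const[of q]] u(2)] .
  ultimately have "\<forall>\<^sub>F n in sequentially. False"
    using eventually_in_S[OF u(1)]
  proof eventually_elim
    case (elim n)
    then have "F n u \<in> ball q R" using R(1) by (simp add: dist_commute)
    then obtain g where g: "g holomorphic_on ball q R" "g \<in> ball q R \<rightarrow> S n" "g (F n u) = u"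
      "\<And>y. y \<in> ball q R \<Longrightarrow> F n (g y) = y"
      using lift_ball[OF R(2) elim(3)] by blast
    \<comment> \<open>\<open>a\<close> maps the unit disc onto the ball of radius \<open>R/2\<close>
      about \<open>F n u\<close>, which lies in \<open>ball q R\<close>; since \<open>F n u\<close>
      is within \<open>R/4\<close> of \<open>q\<close>, the point over \<open>q\<close> has norm at
      most 1/2.\<close>
    define a where "a z = F n u + of_real (R/2) * z" for z
    have a: "a z \<in> ball q R" if "z \<in> ball 0 1" for z
    proof -
      have "dist q (a z) \<le> dist q (F n u) + norm (of_real (R/2) * z)"
        using dist_triangle[of q "a z" "F n u"] by (simp add: a_def dist_norm)
      also have "norm (of_real (R/2) * z) \<le> R/2"
        using that R(1) by (simp add: norm_mult)
      finally show ?thesis using elim(2) R(1) by (simp add: dist_commute)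
    qed
    define m where "m z = Moebius_function 0 u (g (a z))" for z
    have ga: "g (a z) \<in> ball 0 1" if "z \<in> ball 0 1" for z
      using g(2) a[OF that] S_subset by blast
    define z where "z = (q - F n u) / of_real (R/2)"
    have az: "a z = q" using R(1) by (simp add: a_def z_def field_simps)
    have z: "norm z \<le> 1/2"
    proof -
      have "norm z = norm (q - F n u) / (R/2)" using R(1) by (simp add: z_def norm_divide del: divide_divide_eq_right)
      also have "\<dots> \<le> 1/2" using elim(2) R(1) by (simp add: dist_norm norm_minus_commute field_simps)
      finally show ?thesis .
    qed
    \<comment> \<open>\<open>m\<close> fixes 0 because \<open>g (F n u) = u\<close>. Schwarz
      therefore puts \<open>g q\<close> into \<open>K\<close>, where \<open>F n\<close> is within
      \<open>d\<close> of \<open>G\<close>; but \<open>F n (g q) = q\<close> has distance at least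
      \<open>d\<close> from the image of \<open>K\<close> under \<open>G\<close>.\<close>
    have "norm (m z) \<le> norm z"
    proof (rule Schwarz_Lemma)
      have "(\<lambda>z. g (a z)) holomorphic_on ball 0 1"
        unfolding a_def
        by (rule holomorphic_on_compose_gen[OF _ g(1), unfolded o_def])
           (use a in \<open>auto intro!: holomorphic_intros simp: a_def\<close>)
      then show "m holomorphic_on ball 0 1"
        unfolding m_def
        by (rule holomorphic_on_compose_gen[OF _ Mh[OF u1], unfolded o_def]) (use ga in auto)
      show "norm (m z) < 1" if "norm z < 1" for z
        unfolding m_def using Moebius_function_norm_lt_1[OF u1] ga[of z] that by simp
      show "m 0 = 0" by (simp add: m_def a_def g(3) Moebius_function_eq_zero)
      show "norm z < 1" using z by simp
    qed
    then have "m z \<in> cball 0 (1/2)" using z by simp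
    moreover have "Moebius_function 0 (-u) (m z) = g q"
      unfolding m_def az
      using Moebius_function_compose[of "-u" u "g q"] u1 ga[of z] z az by simp
    ultimately have gK: "g q \<in> K" unfolding K_def by (metis imageI)
    have "F n (g q) = q" using g(4) R(1) by simp
    then have "dist q (G (g q)) < d" using elim(1) gK by force
    then show False using d(2) gK by fastforce
  qed
  then show False by simp
qed

text \<open>The image is open because \<open>G\<close> is nonconstant, and relatively closed by
  \<open>G_image_closed\<close>; connectedness of \<Omega> does the rest.\<close>

lemma G_onto:
  assumes "G 0 \<in> \<Omega>"
  shows "G ` ball 0 1 = \<Omega>"
proof -
  let ?I = "G ` ball 0 1"
  have sub: "?I \<subseteq> \<Omega>" using G_in[OF assms] by blast
  have "\<not> G constant_on ball 0 1"
    using G_not_constant[OF assms, of "1/2"] constant_on_subset[of G "ball 0 1" "ball 0 (1/2)"] subset_ball[of "1/2" 1] by auto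
  then have "open ?I"
    using open_mapping_thm[OF holo_G, of "ball 0 1"] by auto
  then have "openin (top_of_set \<Omega>) ?I" using sub open_\<Omega> by (simp add: openin_open_eq)
  moreover have "closedin (top_of_set \<Omega>) ?I"
    unfolding closedin_closed
    using G_image_closed[OF assms] sub closure_subset[of ?I] by (intro exI[of _ "closure ?I"]) auto
  ultimately have "?I = {} \<or> ?I = \<Omega>" using connected_\<Omega> by (metis connected_clopen)
  then show ?thesis by auto
qed

subsection \<open>Boundary limits\<close>

text \<open>A nonconstant \<open>G\<close> would, by \<open>G_omits\<close> with
  \<open>c = G 0\<close>, omit the very value it takes at 0.\<close>

lemma G_constant:
  assumes "G 0 \<notin> \<Omega>" "z \<in> ball 0 1"
  shows "G z = G 0"
proof -
  obtain r where r: "norm z < r" "r < 1" using assms(2) dense[of "norm z" 1] by auto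
  then have r0: "0 < r" by (meson norm_ge_zero le_less_trans)
  have "G constant_on ball 0 r"
    using G_omits[OF r0 r(2) assms(1), of 0] r0 by auto
  then show ?thesis using r r0 by (auto simp: constant_on_def)
qed

lemma eventually_near_G0:
  assumes "G 0 \<notin> \<Omega>" "r < 1" "e > 0"
  shows "\<forall>\<^sub>F n in sequentially. cball 0 r \<subseteq> S n \<and> (\<forall>z\<in>cball 0 r. F n z \<in> ball (G 0) e)"
proof -
  have K: "cball 0 r \<subseteq> (ball 0 1 :: complex set)" using assms(2) by auto
  have "\<forall>\<^sub>F n in sequentially. \<forall>z\<in>cball 0 r. dist (F n z) (G z) < e"
    using lim_G[OF compact_cball K] assms(3) by (auto simp: uniform_limit_iff)
  then show ?thesis
    using subset_S[OF compact_cball K]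
  proof eventually_elim
    case (elim n)
    have "F n z \<in> ball (G 0) e" if "z \<in> cball 0 r" for z
      using bspec[OF elim(1) that] G_constant[OF assms(1), of z] K that by (auto simp: dist_commute)
    with elim show ?case by blast
  qed
qed

text \<open>For large \<open>n\<close> a compact disc containing \<open>u\<close> and
  \<open>v\<close> is mapped into \<open>W\<close>. The section of \<open>F n\<close> over
  \<open>W\<close> through \<open>u\<close> undoes \<open>F n\<close> on that disc, so
  \<open>F n\<close>, and with it \<pi>, is injective there.\<close>

lemma inj_if_limit_locally_simply_connected:
  assumes "G 0 \<notin> \<Omega>" "open W" "simply_connected W" "W \<subseteq> \<Omega>" "e > 0" "\<Omega> \<inter> ball (G 0) e \<subseteq> W"
  shows "inj_on \<pi> (ball 0 1)"
proof (rule inj_onI)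
  fix u v :: complex assume uv: "u \<in> ball 0 1" "v \<in> ball 0 1" and eq: "\<pi> u = \<pi> v"
  define K where "K = cball (0::complex) (max (norm u) (norm v))"
  have K: "u \<in> K" "v \<in> K" "connected K" by (auto simp: K_def)
  obtain n where n: "K \<subseteq> S n" "\<And>z. z \<in> K \<Longrightarrow> F n z \<in> ball (G 0) e"
    using eventually_happens[OF eventually_near_G0[OF assms(1) _ assms(5), of "max (norm u) (norm v)"]] uv
    unfolding K_def by auto
  have W: "F n z \<in> W" if "z \<in> K" for z using n F_in that assms(6) by blast
  have uS: "u \<in> S n" using n K by blast
  obtain g where g: "g holomorphic_on W" "g \<in> W \<rightarrow> S n" "g (F n u) = u" "\<And>y. y \<in> W \<Longrightarrow> F n (g y) = id y"
    by (rule covering_space_holomorphic_lift_at[OF cov_F open_S holo_F uS W[OF K(1)] assms(3,2), of id])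
       (use assms(4) in \<open>auto simp: holomorphic_on_id\<close>)
  have "g (F n v) = v"
  proof (rule lift_cancel[of K n u "F n" W])
    show "continuous_on K (F n)" using cont_F n(1) continuous_on_subset by blast
    show "continuous_on W g" using g(1) holomorphic_on_imp_continuous_on by blast
  qed (use K n W g in auto)
  moreover have "F n u = F n v" using fibre eq n(1) K by blast
  ultimately show "u = v" using g(3) by metis
qed

text \<open>The period \<open>2\<pi>\<i>\<close> of the exponential covering of a punctured disc lifts to a loop whose length
  in the unit disc tends to zero; it must close up because the fibres of \<open>\<pi>\<close> are discrete.\<close>

lemma inj_if_limit_puncture:
  assumes "G 0 \<notin> \<Omega>" "e > 0" "ball (G 0) e - {G 0} \<subseteq> \<Omega>"
  shows "inj_on \<pi> (ball 0 1)"
proof (rule inj_onI)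
  fix u v :: complex assume uv: "u \<in> ball 0 1" "v \<in> ball 0 1" and eq: "\<pi> u = \<pi> v"
  define p where "p = G 0"
  define K where "K = cball (0::complex) (max (norm u) (norm v))"
  have K: "u \<in> K" "v \<in> K" "connected K" by (auto simp: K_def)
  obtain j where j: "u \<in> S j" using uv Union_S by blast
  \<comment> \<open>On \<open>N\<close> the map \<open>F j\<close> is injective, so distinct points
    of \<open>N\<close> lie in distinct fibres of \<pi>. This is the discreteness that closes the
    lifted loop.\<close>
  obtain N where N: "open N" "u \<in> N" "N \<subseteq> S j" "inj_on (F j) N"
    using covering_space_locally_injective[OF cov_F open_S j] by blast
  obtain d where d: "d > 0" "ball u d \<subseteq> N" using N open_contains_ball by blast
  define H where "H = {w. Re w < ln e}"
  \<comment> \<open>\<open>T > 4 * pi\<close> keeps a translate by the period inside the ball of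
    radius \<open>T/2\<close>; \<open>T > 4 * pi / d\<close> makes the Lipschitz bound
    \<open>2/T * 2 * pi\<close> smaller than \<open>d\<close>.\<close>
  define T where "T = max (4 * pi) (4 * pi / d) + 1"
  have T: "T > 4 * pi" "T > 4 * pi / d" "T > 0" 
    using pi_gt_zero d(1) by (auto simp: T_def max_def intro!: add_pos_pos divide_pos_pos)
  \<comment> \<open>Values of \<open>F n\<close> this close to the puncture have logarithms at depth
    more than \<open>T\<close> in \<open>H\<close>, so balls of radius \<open>T\<close> about them
    stay in \<open>H\<close>.\<close>
  define e' where "e' = exp (ln e - T)"
  have e': "0 < e'" "e' < e"
    using T(3) assms(2) exp_less_cancel_iff[of "ln e - T" "ln e"] by (auto simp: e'_def)
  obtain n where n: "K \<subseteq> S n" "\<And>z. z \<in> K \<Longrightarrow> F n z \<in> ball p e'"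
    using eventually_happens[OF eventually_near_G0[OF assms(1) _ e'(1), of "max (norm u) (norm v)"]] uv
    unfolding K_def p_def by auto
  have nz: "F n z - p \<noteq> 0" if "z \<in> K" for z
    using F_in n(1) that assms(1) unfolding p_def by fastforce
  have contFK: "continuous_on K (F n)" using cont_F n(1) continuous_on_subset by blast
  obtain L where L: "continuous_on K L" "\<And>z. z \<in> K \<Longrightarrow> F n z - p = exp (L z)"
    unfolding K_def
    by (rule continuous_logarithm_on_cball[of 0 "max (norm u) (norm v)" "\<lambda>z. F n z - p"])
       (use nz contFK in \<open>auto intro!: continuous_intros simp: K_def\<close>)
  have LT: "Re (L z) < ln e - T" if "z \<in> K" for z
  proof -
    have "exp (Re (L z)) = norm (F n z - p)" using L(2)[OF that] by simp
    also have "\<dots> < exp (ln e - T)" using n(2)[OF that] by (simp add: e'_def dist_norm norm_minus_commute)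
    finally show ?thesis by simp
  qed
  have LH: "L z \<in> H" if "z \<in> K" for z using LT[OF that] T(3) by (simp add: H_def)
  have H: "open H" "convex H" unfolding H_def by (auto simp: open_halfspace_Re_lt convex_halfspace_Re_lt)
  \<comment> \<open>\<open>E\<close> is the universal covering of the punctured disc by the half
    plane \<open>H\<close>; its lift \<open>g\<close> through \<open>F n\<close> undoes the
    logarithm \<open>L\<close>.\<close>
  define E where "E w = p + exp w" for w
  have E: "E \<in> H \<rightarrow> \<Omega>"
  proof
    fix w assume "w \<in> H"
    then have "exp (Re w) < exp (ln e)" unfolding H_def exp_less_cancel_iff by simp
    then have "E w \<in> ball (G 0) e - {G 0}"
      using assms(2) by (simp add: E_def p_def dist_norm)
    then show "E w \<in> \<Omega>" using assms(3) by blast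
  qed
  have holE: "E holomorphic_on H" unfolding E_def by (intro holomorphic_intros)
  have uS: "u \<in> S n" using n K by blast
  have ELu: "E (L u) = F n u" using L(2)[OF K(1)] by (simp add: E_def algebra_simps)
  obtain g where g: "g holomorphic_on H" "g \<in> H \<rightarrow> S n" "g (L u) = u" "\<And>y. y \<in> H \<Longrightarrow> F n (g y) = E y"
    using covering_space_holomorphic_lift_at[OF cov_F open_S holo_F uS LH[OF K(1)]
          convex_imp_simply_connected[OF H(2)] H(1) holE E ELu] by blast
  have contg: "continuous_on H g" using g(1) holomorphic_on_imp_continuous_on by blast
  have gL: "g (L z) = z" if "z \<in> K" for z
  proof (rule lift_cancel[of K n u L H])
    show "F n (g (L z)) = F n z" if "z \<in> K" for z
      using g(4)[OF LH[OF that]] L(2)[OF that] by (simp add: E_def algebra_simps)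
  qed (use K n LH g L contg that in auto)
  define \<tau> where "\<tau> = 2 * of_real pi * \<i>"
  have shift: "w + of_nat k * \<tau> \<in> H" if "w \<in> H" for w k using that by (simp add: H_def \<tau>_def)
  have expt: "E (w + \<tau>) = E w" for w by (simp add: E_def \<tau>_def exp_add exp_two_pi_i' mult_ac)
  let ?w = "L u"
  have ball: "ball ?w T \<subseteq> H"
  proof
    fix w assume "w \<in> ball ?w T"
    then have "\<bar>Re w - Re ?w\<bar> < T"
      using abs_Re_le_cmod[of "w - ?w"] by (simp add: dist_norm norm_minus_commute)
    then show "w \<in> H" using LT[OF K(1)] by (simp add: H_def)
  qed
  have w1: "?w + \<tau> \<in> H" using shift[OF LH[OF K(1)], of 1] by simp
  \<comment> \<open>The translated point lands within \<open>d\<close> of \<open>u\<close>, hence in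
    \<open>N\<close>, and in the fibre of \<open>u\<close>; so it is \<open>u\<close>.\<close>
  have g1: "g (?w + \<tau>) = u"
  proof -
    have "norm (g (?w + \<tau>) - g ?w) \<le> 2/T * norm (?w + \<tau> - ?w)"
    proof (rule holomorphic_bounded_imp_Lipschitz[where c = ?w])
      show "g holomorphic_on ball ?w T" using g(1) ball holomorphic_on_subset by blast
      show "norm (g z) \<le> 1" if "z \<in> ball ?w T" for z
      proof -
        have "g z \<in> S n" using g(2) ball that by blast
        then show ?thesis using norm_S[of "g z" n] by simp
      qed
      show "?w \<in> ball ?w (T/2)" using T(3) by simp
      show "?w + \<tau> \<in> ball ?w (T/2)" using T(1) by (simp add: \<tau>_def dist_norm norm_mult)
    qed
    also have "\<dots> = 4 * pi / T" by (simp add: \<tau>_def norm_mult)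
    also have "\<dots> < d" using T(2,3) d(1) by (simp add: field_simps)
    finally have "g (?w + \<tau>) \<in> ball u d" using g(3) by (simp add: dist_norm norm_minus_commute)
    then have gN: "g (?w + \<tau>) \<in> N" using d by blast
    have gS: "g (?w + \<tau>) \<in> S n" using g(2) w1 by blast
    have "F n (g (?w + \<tau>)) = F n u" using g(4)[OF w1] expt ELu by simp
    then have "\<pi> (g (?w + \<tau>)) = \<pi> u" using fibre gS uS by blast
    then have "F j (g (?w + \<tau>)) = F j u" using fibre[of _ j] gN N(3) j by blast
    then show ?thesis using N(2,4) gN by (meson inj_onD)
  qed
  \<comment> \<open>Two lifts of the periodic map \<open>E\<close> that agree at one point agree on
    all of \<open>H\<close>.\<close>
  have per: "g (w + \<tau>) = g w" if "w \<in> H" for w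
  proof (rule covering_space_lift_unique[OF cov_F[of n], where f = E and T = H and a = ?w
        and ?g1.0 = "\<lambda>w. g (w + \<tau>)" and ?g2.0 = g])
    have sh: "x + \<tau> \<in> H" if "x \<in> H" for x using shift[OF that, of 1] by simp
    show "continuous_on H (\<lambda>w. g (w + \<tau>))"
      by (rule continuous_on_compose2[OF contg]) (auto intro!: continuous_intros sh)
    show "(\<lambda>w. g (w + \<tau>)) \<in> H \<rightarrow> S n" using g(2) sh by auto
    show "E x = F n (g (x + \<tau>))" if "x \<in> H" for x using g(4)[OF sh[OF that]] expt by simp
  qed (use g g1 contg E holE H LH K that in \<open>auto intro: holomorphic_on_imp_continuous_on convex_connected\<close>)
  have pern: "g (w + of_nat k * \<tau>) = g w" if "w \<in> H" for w k
  proof (induction k)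
    case (Suc k)
    have "g (w + of_nat (Suc k) * \<tau>) = g ((w + of_nat k * \<tau>) + \<tau>)" by (simp add: algebra_simps)
    then show ?case using per[OF shift[OF that]] Suc by simp
  qed simp
  \<comment> \<open>Points of one fibre have logarithms that differ by a multiple of the period,
    which \<open>g\<close> does not see. The sign of \<open>k\<close> matters because
    \<open>pern\<close> covers natural multiples only.\<close>
  have "F n u = F n v" using fibre eq n(1) K by blast
  then have "exp (L v) = exp (L u)" using L(2)[OF K(1)] L(2)[OF K(2)] by simp
  then obtain k :: int where k: "L v = L u + of_int k * \<tau>"
    unfolding exp_eq by (auto simp: \<tau>_def mult_ac)
  have "g (L v) = g (L u)"
  proof (cases "k \<ge> 0")
    case True
    then show ?thesis using pern[OF LH[OF K(1)], of "nat k"] k by simp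
  next
    case False
    then have "L u = L v + of_nat (nat (-k)) * \<tau>" using k by simp
    then show ?thesis using pern[OF LH[OF K(2)], of "nat (-k)"] by simp
  qed
  then show "u = v" using gL K by simp
qed

end

section \<open>Smooth boundary points\<close>

text \<open>The nonzero gradient makes \<open>\<rho>\<close> increase in one direction
  \<open>v\<close> throughout a neighbourhood, so near \<open>p\<close> the set \<open>D\<close> can
  be pushed along that direction and contracted. The radius \<delta> lets the piece avoid finitely
  many punctures.\<close>

lemma C2_boundary_locally_simply_connected:
  assumes "open D" "C2_boundary D" "p \<in> frontier D" "\<delta> > 0"
  obtains W e where "open W" "simply_connected W" "W \<subseteq> D \<inter> ball p \<delta>" "e > 0" "D \<inter> ball p e \<subseteq> W"
proof -
  obtain r and \<rho> :: "complex \<Rightarrow> real" where r: "r > 0" and C2: "C2_on (ball p r) \<rho>"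
    and D: "D \<inter> ball p r = {z\<in>ball p r. \<rho> z < 0}"
    and nz: "\<forall>z\<in>ball p r. \<rho> z = 0 \<longrightarrow> (\<exists>D. (\<rho> has_derivative D) (at z) \<and> D \<noteq> (\<lambda>_. 0))"
    using bspec[OF assms(2)[unfolded C2_boundary_def] assms(3)] by (elim exE conjE) (rule that, assumption+)
  obtain \<rho>' where \<rho>': "\<And>z. z \<in> ball p r \<Longrightarrow> (\<rho> has_derivative blinfun_apply (\<rho>' z)) (at z)"
    and C1: "C1_on (ball p r) \<rho>'"
    using C2 unfolding C2_on_def by blast
  have cont': "continuous_on (ball p r) \<rho>'"
    using C1 unfolding C1_on_def
    by (auto intro!: continuous_at_imp_continuous_on intro: has_derivative_continuous)
  have cont: "continuous_on (ball p r) \<rho>"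
    using has_derivative_continuous[OF \<rho>'] by (intro continuous_at_imp_continuous_on) blast
  have "p \<notin> D" using assms(1,3) by (auto simp: frontier_def interior_open)
  then have "\<rho> p \<ge> 0" using D r by force
  moreover have "\<rho> p \<le> 0"
  proof (rule ccontr)
    assume "\<not> \<rho> p \<le> 0"
    then obtain d where d: "d > 0" "\<And>z. z \<in> ball p r \<Longrightarrow> dist z p < d \<Longrightarrow> dist (\<rho> z) (\<rho> p) < \<rho> p"
      using bspec[OF cont[unfolded continuous_on_iff], of p] r
      by (auto simp: not_le dest!: spec[of _ "\<rho> p"])
    have "p \<in> closure D" using assms(3) by (simp add: frontier_def)
    then obtain z where z: "z \<in> D" "dist z p < min d r"
      using closure_approachable[of p D] d(1) r by (auto dest!: spec[of _ "min d r"])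
    then have zb: "z \<in> ball p r" by (simp add: dist_commute)
    then have "\<rho> z < 0" using D z(1) by blast
    then show False using d(2)[OF zb] z(2) by (simp add: dist_real_def)
  qed
  ultimately have \<rho>p: "\<rho> p = 0" by simp
  have "blinfun_apply (\<rho>' p) \<noteq> (\<lambda>_. 0)"
  proof -
    obtain E where "(\<rho> has_derivative E) (at p)" "E \<noteq> (\<lambda>_. 0)"
      using bspec[OF nz, of p] r \<rho>p by auto
    then show ?thesis using has_derivative_unique[OF \<rho>'[of p]] r by auto
  qed
  then obtain v0 where v0: "blinfun_apply (\<rho>' p) v0 \<noteq> 0" by blast
  then have v0n: "v0 \<noteq> 0" by (metis blinfun.zero_right)
  \<comment> \<open>The sign makes the derivative of \<open>\<rho>\<close> along \<open>v\<close>
    positive; unit length makes \<open>(s, t)\<close> in \<open>p + (s + i t) v\<close> isometric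
    coordinates.\<close>
  define v where "v = (sgn (blinfun_apply (\<rho>' p) v0) / norm v0) *\<^sub>R v0"
  have v: "norm v = 1" using v0 v0n by (simp add: v_def)
  have vpos: "blinfun_apply (\<rho>' p) v > 0"
    using v0 v0n by (auto simp: v_def blinfun.scaleR_right sgn_real_def zero_less_divide_iff)
  have vn: "v \<noteq> 0" using v by auto
  have cont_v: "continuous_on (ball p r) (\<lambda>z. blinfun_apply (\<rho>' z) v)"
    by (intro continuous_intros cont')
  obtain d where d: "d > 0" "\<And>z. z \<in> ball p r \<Longrightarrow> dist z p < d \<Longrightarrow>
      dist (blinfun_apply (\<rho>' z) v) (blinfun_apply (\<rho>' p) v) < blinfun_apply (\<rho>' p) v"
    using bspec[OF cont_v[unfolded continuous_on_iff], of p] vpos r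
    by (auto dest!: spec[of _ "blinfun_apply (\<rho>' p) v"])
  \<comment> \<open>A point with both coordinates below \<open>h\<close> lies within
    \<open>2 * h\<close> of \<open>p\<close>, hence within each of \<open>d\<close>,
    \<open>r\<close> and \<delta>.\<close>
  define h where "h = min (min d r) \<delta> / 2"
  have h: "h > 0" using d r assms(4) by (simp add: h_def)
  define \<Phi> where "\<Phi> s t = p + Complex s t * v" for s t
  have normc: "norm (Complex s t) \<le> \<bar>s\<bar> + \<bar>t\<bar>" for s t
    using cmod_le[of "Complex s t"] by simp
  have \<Phi>_ball: "\<Phi> s t \<in> ball p (2*h)" if "\<bar>s\<bar> < h" "\<bar>t\<bar> < h" for s t
    using normc[of s t] that by (simp add: \<Phi>_def dist_norm norm_mult v)
  have \<Phi>_in: "\<Phi> s t \<in> ball p r" "\<Phi> s t \<in> ball p \<delta>" "dist (\<Phi> s t) p < d" if "\<bar>s\<bar> < h" "\<bar>t\<bar> < h" for s t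
    using \<Phi>_ball[OF that] by (auto simp: h_def dist_commute)
  have der: "((\<lambda>x. \<rho> (\<Phi> x t)) has_real_derivative blinfun_apply (\<rho>' (\<Phi> x t)) v) (at x)"
    if "\<bar>x\<bar> < h" "\<bar>t\<bar> < h" for x t
  proof -
    have "((\<lambda>x. \<Phi> x t) has_derivative (\<lambda>k. of_real k * v)) (at x)"
      unfolding \<Phi>_def Complex_eq by (auto intro!: derivative_eq_intros)
    then have "((\<lambda>x. \<rho> (\<Phi> x t)) has_derivative (\<lambda>k. blinfun_apply (\<rho>' (\<Phi> x t)) (of_real k * v))) (at x)"
      using has_derivative_compose[of "\<lambda>x. \<Phi> x t" _ x UNIV \<rho>] \<rho>'[OF \<Phi>_in(1)[OF that]] by blast
    then show ?thesis
      unfolding has_field_derivative_def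
      by (simp add: scaleR_conv_of_real[symmetric] blinfun.scaleR_right mult.commute[of _ "blinfun_apply _ _"])
  qed
  have incr: "\<rho> (\<Phi> s t) \<le> \<rho> (\<Phi> s' t)" if "s \<le> s'" "\<bar>s\<bar> < h" "\<bar>s'\<bar> < h" "\<bar>t\<bar> < h" for s s' t
  proof (rule DERIV_nonneg_imp_nondecreasing[OF that(1)])
    fix x assume "s \<le> x" "x \<le> s'"
    then have x: "\<bar>x\<bar> < h" using that by auto
    note der[OF x that(4)]
    moreover have "blinfun_apply (\<rho>' (\<Phi> x t)) v \<ge> 0"
      using d(2)[OF \<Phi>_in(1,3)[OF x that(4)]] by (simp add: dist_real_def)
    ultimately show "\<exists>y. ((\<lambda>x. \<rho> (\<Phi> x t)) has_real_derivative y) (at x) \<and> 0 \<le> y" by blast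
  qed
  \<comment> \<open>Since \<open>\<rho>\<close> vanishes at \<open>p\<close> with positive
    derivative along \<open>v\<close>, it is negative just below \<open>p\<close>; monotonicity
    carries this down to \<open>s = -h/2\<close>.\<close>
  have neg: "\<rho> (\<Phi> (-h/2) 0) < 0"
  proof -
    have \<Phi>0: "\<Phi> 0 0 = p" by (simp add: \<Phi>_def Complex_eq)
    have "((\<lambda>x. \<rho> (\<Phi> x 0)) has_real_derivative blinfun_apply (\<rho>' p) v) (at 0)"
      using der[of 0 0] h \<Phi>0 by simp
    then obtain \<eta> where \<eta>: "\<eta> > 0"
      "\<And>k. k > 0 \<Longrightarrow> k < \<eta> \<Longrightarrow> \<rho> (\<Phi> (0 - k) 0) < \<rho> (\<Phi> 0 0)"
      using DERIV_pos_inc_left[of "\<lambda>x. \<rho> (\<Phi> x 0)"] vpos by blast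
    define k where "k = min (\<eta>/2) (h/2)"
    have k: "k > 0" "k < \<eta>" "k \<le> h/2" using \<eta>(1) h by (auto simp: k_def)
    have "\<rho> (\<Phi> (-h/2) 0) \<le> \<rho> (\<Phi> (-k) 0)" using k h by (intro incr) auto
    also have "\<dots> < 0" using \<eta>(2)[OF k(1,2)] \<rho>p \<Phi>0 by simp
    finally show ?thesis .
  qed
  \<comment> \<open>Continuity spreads the sign to a transversal segment, whose half-length
    \<open>c\<close> becomes the half-width of the box.\<close>
  have "isCont (\<lambda>t. \<rho> (\<Phi> (-h/2) t)) 0"
  proof (rule isCont_o2[where g = \<rho>])
    show "isCont (\<lambda>t. \<Phi> (-h/2) t) 0" unfolding \<Phi>_def Complex_eq by (intro continuous_intros)
    show "isCont \<rho> (\<Phi> (-h/2) 0)"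
      using \<rho>'[OF \<Phi>_in(1), of "-h/2" 0] h by (auto intro: has_derivative_continuous)
  qed
  then have "\<forall>\<^sub>F t in at 0. \<rho> (\<Phi> (-h/2) t) < 0"
    using neg by (auto simp: isCont_def intro: order_tendstoD(2))
  then obtain b where b: "b > 0" "\<And>t. t \<noteq> 0 \<Longrightarrow> \<bar>t\<bar> < b \<Longrightarrow> \<rho> (\<Phi> (-h/2) t) < 0"
    by (auto simp: eventually_at)
  define c where "c = min b h"
  have c: "c > 0" "c \<le> h" using b h by (auto simp: c_def)
  have bottom: "\<rho> (\<Phi> (-h/2) t) < 0" if "\<bar>t\<bar> < c" for t
    using b(2)[of t] neg that by (cases "t = 0") (auto simp: c_def)
  define s where "s z = Re ((z - p) / v)" for z
  define t where "t z = Im ((z - p) / v)" for z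
  have \<Phi>_st: "\<Phi> (s z) (t z) = z" for z using vn by (simp add: \<Phi>_def s_def t_def)
  have st_\<Phi>: "s (\<Phi> x y) = x" "t (\<Phi> x y) = y" for x y using vn by (simp_all add: \<Phi>_def s_def t_def)
  have st_cont: "continuous_on A s" "continuous_on A t" for A
    unfolding s_def t_def by (intro continuous_intros; use vn in simp)+
  have st_norm: "\<bar>s z\<bar> \<le> dist z p" "\<bar>t z\<bar> \<le> dist z p" for z
    using abs_Re_le_cmod[of "(z-p)/v"] abs_Im_le_cmod[of "(z-p)/v"] v
    by (simp_all add: s_def t_def dist_norm norm_divide)
  \<comment> \<open>A box around \<open>p\<close> on which \<open>\<rho>\<close> increases in the direction \<open>v\<close> and is negative on the segment
    \<open>s = -h/2\<close>; its part in \<open>D\<close> retracts first along \<open>v\<close> onto that segment and then to a point.\<close>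
  define Q where "Q = {z. \<bar>s z\<bar> < h \<and> \<bar>t z\<bar> < c}"
  define W where "W = D \<inter> Q"
  have Qr: "z \<in> ball p r" "z \<in> ball p \<delta>" if "z \<in> Q" for z
    using \<Phi>_in[of "s z" "t z"] that c \<Phi>_st by (auto simp: Q_def)
  have W_iff: "\<Phi> x y \<in> W \<longleftrightarrow> \<rho> (\<Phi> x y) < 0" if "\<bar>x\<bar> < h" "\<bar>y\<bar> < c" for x y
  proof -
    have "\<Phi> x y \<in> Q" using that by (simp add: Q_def st_\<Phi>)
    then show ?thesis using Qr D by (auto simp: W_def)
  qed
  have seg: "closed_segment (\<Phi> x y) (\<Phi> x' y') \<subseteq> W"
    if "\<And>k. 0 \<le> k \<Longrightarrow> k \<le> 1 \<Longrightarrow> \<Phi> ((1 - k) * x + k * x') ((1 - k) * y + k * y') \<in> W" for x y x' y'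
  proof
    fix z assume "z \<in> closed_segment (\<Phi> x y) (\<Phi> x' y')"
    then obtain k where k: "0 \<le> k" "k \<le> 1" "z = (1 - k) *\<^sub>R \<Phi> x y + k *\<^sub>R \<Phi> x' y'"
      by (auto simp: closed_segment_def)
    have "z = \<Phi> ((1 - k) * x + k * x') ((1 - k) * y + k * y')"
      unfolding k(3) \<Phi>_def Complex_eq by (simp add: scaleR_conv_of_real algebra_simps)
    then show "z \<in> W" using that k(1,2) by simp
  qed
  have "open Q" unfolding Q_def
    by (intro open_Collect_conj open_Collect_less continuous_intros st_cont)
  then have "open W" using assms(1) by (simp add: W_def open_Int)
  define j where "j z = \<Phi> (-h/2) (t z)" for z
  have contj: "continuous_on A j" for A
    unfolding j_def \<Phi>_def Complex_eq by (intro continuous_intros st_cont)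
  have hom1: "homotopic_with_canon (\<lambda>_. True) W W id j"
  proof (rule homotopic_with_linear)
    fix z assume z: "z \<in> W"
    then have st: "\<bar>s z\<bar> < h" "\<bar>t z\<bar> < c" by (auto simp: W_def Q_def)
    then have neg_z: "\<rho> (\<Phi> (s z) (t z)) < 0" using W_iff[OF st] \<Phi>_st z by simp
    have "closed_segment (\<Phi> (s z) (t z)) (\<Phi> (-h/2) (t z)) \<subseteq> W"
    proof (rule seg)
      fix k :: real assume k: "0 \<le> k" "k \<le> 1"
      define x where "x = (1 - k) * s z + k * (-h/2)"
      have "x \<in> closed_segment (s z) (-h/2)" using k by (auto simp: closed_segment_def x_def)
      then have "x \<in> {min (s z) (-h/2)..max (s z) (-h/2)}" by (auto simp: closed_segment_eq_real_ivl min_def max_def split: if_splits)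
      then have x: "\<bar>x\<bar> < h" "x \<le> max (s z) (-h/2)" using st h by (auto simp: min_def max_def split: if_splits)
      \<comment> \<open>The path to \<open>s = -h/2\<close> may run down or up, but \<open>x\<close>
        never exceeds the larger of its two end values, and \<open>\<rho>\<close> is negative at
        both ends.\<close>
      have "\<rho> (\<Phi> x (t z)) < 0"
      proof (cases "x \<le> s z")
        case True
        then have "\<rho> (\<Phi> x (t z)) \<le> \<rho> (\<Phi> (s z) (t z))" using x st c by (intro incr) auto
        then show ?thesis using neg_z by simp
      next
        case False
        then have "\<rho> (\<Phi> x (t z)) \<le> \<rho> (\<Phi> (-h/2) (t z))" using x st c h by (intro incr) auto
        then show ?thesis using bottom[OF st(2)] by simp
      qed
      then show "\<Phi> ((1 - k) * s z + k * (- h / 2)) ((1 - k) * t z + k * t z) \<in> W"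
        using W_iff[OF x(1) st(2)] by (simp add: x_def algebra_simps)
    qed
    then show "closed_segment (id z) (j z) \<subseteq> W" by (simp add: \<Phi>_st j_def)
  qed (auto intro: contj)
  have hom2: "homotopic_with_canon (\<lambda>_. True) W W j (\<lambda>_. \<Phi> (-h/2) 0)"
  proof (rule homotopic_with_linear)
    fix z assume "z \<in> W"
    then have st: "\<bar>t z\<bar> < c" by (auto simp: W_def Q_def)
    show "closed_segment (j z) (\<Phi> (-h/2) 0) \<subseteq> W" unfolding j_def
    proof (rule seg)
      fix k :: real assume k: "0 \<le> k" "k \<le> 1"
      have "\<bar>(1 - k) * t z\<bar> \<le> \<bar>t z\<bar>" using k by (simp add: abs_mult mult_left_le_one_le)
      then have "\<bar>(1 - k) * t z\<bar> < c" using st by simp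
      then show "\<Phi> ((1 - k) * (- h / 2) + k * (- h / 2)) ((1 - k) * t z + k * 0) \<in> W"
        using W_iff[of "-h/2" "(1 - k) * t z"] bottom[of "(1 - k) * t z"] h
        unfolding distrib_right[symmetric] by simp
    qed
  qed (auto intro: contj)
  have "contractible W"
    unfolding contractible_def using homotopic_with_trans[OF hom1 hom2] by (auto simp: id_def)
  then have "simply_connected W" by (rule contractible_imp_simply_connected)
  moreover have "D \<inter> ball p c \<subseteq> W"
  proof
    fix z assume "z \<in> D \<inter> ball p c"
    then have "z \<in> D" "dist z p < c" by (auto simp: dist_commute)
    then show "z \<in> W" using st_norm[of z] c(2) by (simp add: W_def Q_def)
  qed
  moreover have "W \<subseteq> D \<inter> ball p \<delta>" using Qr(2) unfolding W_def by blast
  ultimately show ?thesis using that \<open>open W\<close> c(1) by blast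
qed

section \<open>The alternative for the limit surface\<close>

text \<open>Both cases at once, with \<open>A = {}\<close> for the smooth domain. The limit point
  \<open>G 0\<close> decides: inside \<Omega> the surface is \<Omega>; at a puncture or on the
  frontier of \<open>D\<close> the covering is injective and the surface is the disc.\<close>

lemma biholo_exhaustion_alternative:
  assumes rs: "riemann_surface X At" and \<Omega>: "domain \<Omega>"
    and M: "\<And>j. openin X (M j)" "\<And>j. M j \<subseteq> M (Suc j)" "(\<Union>j. M j) = topspace X"
    and bih: "\<And>j. \<exists>f. biholo X At (M j) \<Omega> f" and hyp: "hyperbolic_rs X At"
    and D: "open D" "bounded D" "C2_boundary D" "finite A" "A \<subseteq> D" "\<Omega> = D - A"
  shows "(\<exists>f. biholo X At (topspace X) \<Omega> f) \<or> (\<exists>f. biholo X At (topspace X) (ball 0 1) f)"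
proof -
  obtain p where p: "holo_into X At (ball 0 1) p" "covering_map (top_of_set (ball 0 1)) X p"
    using hyp unfolding hyperbolic_rs_def by blast
  obtain f where f: "\<And>j. biholo X At (M j) \<Omega> (f j)" using bih by metis
  define S where "S j = ball 0 1 \<inter> p -` M j" for j
  define F where "F j = f j \<circ> p" for j
  have pim: "p ` ball 0 1 = topspace X" using p(2) unfolding covering_map_def by simp
  have openS: "open (S j)" for j unfolding S_def by (rule open_preimage[OF p(1) M(1)])
  have "mono M" using M(2) by (simp add: mono_iff_le_Suc)
  then have monoS: "mono S" unfolding S_def mono_def by blast
  have "p z \<in> (\<Union>j. M j)" if "z \<in> ball 0 1" for z using pim that unfolding M(3) by blast
  then have UnS: "(\<Union>j. S j) = ball 0 1" unfolding S_def by blast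
  have holF: "F j holomorphic_on S j" for j
    unfolding F_def S_def using f[of j] holo_fun_pullback[OF rs p(1)] by (simp add: biholo_def)
  have covF: "covering_space (S j) (F j) \<Omega>" for j
    unfolding F_def S_def by (rule covering_space_pullback[OF rs p f])
  have inj: "inj_on (f j) (M j)" for j using f[of j] by (simp add: biholo_def bij_betw_def)
  have fib: "F j u = F j v \<longleftrightarrow> p u = p v" if "u \<in> S j" "v \<in> S j" for j u v
    using inj_on_eq_iff[OF inj[of j], of "p u" "p v"] that by (simp add: F_def S_def)
  have sat: "v \<in> S j" if "u \<in> S j" "v \<in> ball 0 1" "p u = p v" for j u v
    using that by (simp add: S_def)
  obtain B where B: "\<And>z. z \<in> D \<Longrightarrow> norm z \<le> B" using D(2) by (auto simp: bounded_iff)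
  have BF: "norm (F j z) \<le> B" if "z \<in> S j" for j z
    using covF[of j] that D(6) B by (auto simp: covering_space_def)
  obtain s G where s: "strict_mono s" and G: "G holomorphic_on ball 0 1"
    "\<And>K. \<lbrakk>compact K; K \<subseteq> ball 0 1\<rbrakk> \<Longrightarrow> uniform_limit K (F \<circ> s) G sequentially"
    using Montel_exhaustion[OF openS monoS UnS holF BF] by blast
  \<comment> \<open>The sets indexed by the subsequence still exhaust the disc.\<close>
  have sub: "S j \<subseteq> S (s j)" for j using monoD[OF monoS seq_suble[OF s]] .
  have UnSs: "(\<Union>j. (S \<circ> s) j) = ball 0 1"
  proof
    show "(\<Union>j. (S \<circ> s) j) \<subseteq> ball 0 1" by (auto simp: S_def)
    show "ball 0 1 \<subseteq> (\<Union>j. (S \<circ> s) j)" using sub unfolding UnS[symmetric] o_def by blast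
  qed
  have monoSs: "mono (S \<circ> s)"
    using monoS strict_mono_mono[OF s] by (auto simp: mono_def)
  interpret convergent_covering_exhaustion "S \<circ> s" "F \<circ> s" \<Omega> p G
  proof unfold_locales
    show "(\<Union>j. (S \<circ> s) j) = ball 0 1" by (rule UnSs)
    show "mono (S \<circ> s)" by (rule monoSs)
    show "uniform_limit K (F \<circ> s) G sequentially" if "compact K" "K \<subseteq> ball 0 1" for K
      using G(2) that .
    show "v \<in> (S \<circ> s) j" if "u \<in> (S \<circ> s) j" "v \<in> ball 0 1" "p u = p v" for j u v
      using sat that by simp
    show "(F \<circ> s) j u = (F \<circ> s) j v \<longleftrightarrow> p u = p v" if "u \<in> (S \<circ> s) j" "v \<in> (S \<circ> s) j" for j u v
      using fib[of u "s j" v] that by simp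
  qed (use openS holF covF \<Omega> G(1) in \<open>simp_all add: domain_def\<close>)
  have disc: "\<exists>f. biholo X At (topspace X) (ball 0 1) f" if "inj_on p (ball 0 1)"
    using that by (intro biholo_if_same_fibres[OF rs p, of id]) (auto simp: inj_on_eq_iff)
  show ?thesis
  proof (cases "G 0 \<in> \<Omega>")
    case True
    then show ?thesis
      using biholo_if_same_fibres[OF rs p holo_G G_onto[OF True] open_\<Omega> G_fibre_iff[OF True]] by blast
  next
    case notin: False
    have "inj_on p (ball 0 1)"
    proof (cases "G 0 \<in> A")
      case True
      \<comment> \<open>The ball must avoid the other punctures as well as the complement of
        \<open>D\<close>.\<close>
      have "open (D - (A - {G 0}))" using D(1,4) by (intro open_Diff finite_imp_closed) auto
      moreover have "G 0 \<in> D - (A - {G 0})" using True D(5) by blast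
      ultimately obtain e where "e > 0" "ball (G 0) e \<subseteq> D - (A - {G 0})"
        using open_contains_ball by blast
      then show ?thesis
        using D(6) by (intro inj_if_limit_puncture[OF notin, of e]) auto
    next
      case False
      have "G 0 \<in> closure D" using G_closure[of 0] closure_mono[of \<Omega> D] D(6) by auto
      then have fr: "G 0 \<in> frontier D"
        using notin False D(1,6) by (auto simp: frontier_def interior_open)
      \<comment> \<open>A radius that excludes \<open>A\<close> ensures that the simply connected
        piece of \<open>D\<close> lies in \<Omega>.\<close>
      have "open (- A)" using D(4) by (simp add: finite_imp_closed open_Compl)
      then obtain \<delta> where \<delta>: "\<delta> > 0" "ball (G 0) \<delta> \<subseteq> - A"
        using False open_contains_ball by blast
      obtain W e where W: "open W" "simply_connected W" "W \<subseteq> D \<inter> ball (G 0) \<delta>" "e > 0" "D \<inter> ball (G 0) e \<subseteq> W"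
        using C2_boundary_locally_simply_connected[OF D(1,3) fr \<delta>(1)] by blast
      show ?thesis
        by (rule inj_if_limit_locally_simply_connected[OF notin W(1,2) _ W(4)]) (use W(3,5) \<delta>(2) D(6) in auto)
    qed
    then show ?thesis using disc by blast
  qed
qed

theorem theorem1p1:
  fixes X :: "'a topology" and At :: "('a set \<times> ('a \<Rightarrow> complex)) set"
    and \<Omega> :: "complex set" and M :: "nat \<Rightarrow> 'a set"
  assumes "riemann_surface X At"
    and "domain \<Omega>"
    and "\<And>j. openin X (M j)"
    and "\<And>j. M j \<subseteq> M (Suc j)"
    and "(\<Union>j. M j) = topspace X"
    and "\<And>j. \<exists>f. biholo X At (M j) \<Omega> f"
    and "hyperbolic_rs X At"
  shows "(bounded \<Omega> \<and> C2_boundary \<Omega> \<longrightarrow>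
            (\<exists>f. biholo X At (topspace X) \<Omega> f) \<or> (\<exists>f. biholo X At (topspace X) (ball 0 1) f))
       \<and> (\<forall>D A. domain D \<and> bounded D \<and> C2_boundary D \<and> finite A \<and> A \<subseteq> D \<and> \<Omega> = D - A \<longrightarrow>
            (\<exists>f. biholo X At (topspace X) \<Omega> f) \<or> (\<exists>f. biholo X At (topspace X) (ball 0 1) f))"
proof (intro conjI allI impI; elim conjE)
  assume "bounded \<Omega>" "C2_boundary \<Omega>"
  then show "(\<exists>f. biholo X At (topspace X) \<Omega> f) \<or> (\<exists>f. biholo X At (topspace X) (ball 0 1) f)"
    using assms(2) by (intro biholo_exhaustion_alternative[OF assms, where D = \<Omega> and A = "{}"]) (auto simp: domain_def)
next
  fix D A assume "domain D" "bounded D" "C2_boundary D" "finite A" "A \<subseteq> D" "\<Omega> = D - A"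
  then show "(\<exists>f. biholo X At (topspace X) \<Omega> f) \<or> (\<exists>f. biholo X At (topspace X) (ball 0 1) f)"
    by (intro biholo_exhaustion_alternative[OF assms, where D = D and A = A]) (auto simp: domain_def)
qed

end
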